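(* Let $\Omega\subseteq\mathbb{R}^N$ be a region, let $m\ge1$ be an integer, let $H_m$ be the polyharmonic operator of order $2m$ acting in $L^2(\Omega)$ with Dirichlet boundary conditions, and let $a_m$ be the pseudodistance of $\Omega$. Then, in the quadratic form sense, \[ H_m\ge\frac{(N+2m-2)(N+2m-4)\cdots N\,(2m-1)(2m-3)\cdots1}{4^m a_m^{2m}}, \] i.e. for all $f\in W_0^{m,2}(\Omega)$, \[ \frac{(N+2m-2)(N+2m-4)\cdots N\,(2m-1)(2m-3)\cdots1}{4^m}\int_\Omega\frac{|f(x)|^2}{a_m(x)^{2m}}\,dx\le Q_m(f). \]
   Context: $Q_m$ is the closure of the quadratic form $Q_m(f)=\langle(-\Delta)^m f,f\rangle=\int_{\mathbb{R}^N}|\xi|^{2m}|\hat f(\xi)|^2\,d\xi$ defined on $C_c^\infty(\Omega)\subseteq L^2(\Omega)$; its domain is $W_0^{m,2}(\Omega)$, and $H_m$ is the non-negative self-adjoint operator associated with $Q_m$. For $\omega\in S^{N-1}$, $d_\omega(x)=\min\{|s|:x+s\omega\notin\Omega\}\in(0,+\infty]$, and $a_m(x)=\left[\int_{S^{N-1}}d_\omega(x)^{-2m}\,d^{N-1}\omega\right]^{-1/(2m)}\in(0,+\infty]$, where $d^{N-1}\omega$ is normalized surface measure on $S^{N-1}$. The products denote $\prod_{k=0}^{m-1}(N+2k)$ and $\prod_{k=0}^{m-1}(2k+1)$. *)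

theory Defs
  imports "HOL-Analysis.Analysis"
begin

definition pd :: "'a::euclidean_space \<Rightarrow> ('a \<Rightarrow> complex) \<Rightarrow> 'a \<Rightarrow> complex" where
  "pd b f x = frechet_derivative f (at x) b"

fun iter_pd :: "'a::euclidean_space list \<Rightarrow> ('a \<Rightarrow> complex) \<Rightarrow> 'a \<Rightarrow> complex" where
  "iter_pd [] f = f"
| "iter_pd (b # bs) f = pd b (iter_pd bs f)"

definition smooth_fun :: "('a::euclidean_space \<Rightarrow> complex) \<Rightarrow> bool" where
  "smooth_fun f \<longleftrightarrow> (\<forall>bs. set bs \<subseteq> Basis \<longrightarrow> (\<forall>x. iter_pd bs f differentiable (at x)))"

definition test_fun :: "'a::euclidean_space set \<Rightarrow> ('a \<Rightarrow> complex) \<Rightarrow> bool" where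
  "test_fun \<Omega> f \<longleftrightarrow> smooth_fun f \<and> compact (closure {x. f x \<noteq> 0})
      \<and> closure {x. f x \<noteq> 0} \<subseteq> \<Omega>"

definition laplacian :: "('a::euclidean_space \<Rightarrow> complex) \<Rightarrow> 'a \<Rightarrow> complex" where
  "laplacian f x = (\<Sum>b\<in>Basis. pd b (pd b f) x)"

definition neg_lap_pow :: "nat \<Rightarrow> ('a::euclidean_space \<Rightarrow> complex) \<Rightarrow> 'a \<Rightarrow> complex" where
  "neg_lap_pow m f = ((\<lambda>g x. - laplacian g x) ^^ m) f"

text \<open>The quadratic form Q_m(f) = <(-Delta)^m f, f> on test functions (it is real there).\<close>
definition Qm :: "nat \<Rightarrow> ('a::euclidean_space \<Rightarrow> complex) \<Rightarrow> real" where
  "Qm m f = Re (integral\<^sup>L lborel (\<lambda>x. neg_lap_pow m f x * cnj (f x)))"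

text \<open>Normalized surface measure on the unit sphere S^{N-1}: the radial projection of the
  uniform probability measure on the unit ball (a measure on the whole space concentrated on
  the sphere).\<close>
definition sphere_measure :: "'a::euclidean_space measure" where
  "sphere_measure = distr (uniform_measure lborel (ball 0 1)) borel (\<lambda>y. y /\<^sub>R norm y)"

definition dist_dir :: "'a::euclidean_space set \<Rightarrow> 'a \<Rightarrow> 'a \<Rightarrow> ennreal" where
  "dist_dir \<Omega> \<omega> x = (INF s\<in>{s::real. x + s *\<^sub>R \<omega> \<notin> \<Omega>}. ennreal \<bar>s\<bar>)"

text \<open>a_m(x)^(-2m) = integral over the sphere of d_omega(x)^(-2m) (with infinity^(-1) = 0).\<close>
definition pseudo_dist_pow_inv :: "nat \<Rightarrow> 'a::euclidean_space set \<Rightarrow> 'a \<Rightarrow> ennreal" where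
  "pseudo_dist_pow_inv m \<Omega> x =
     (\<integral>\<^sup>+ \<omega>. inverse (dist_dir \<Omega> \<omega> x ^ (2 * m)) \<partial>sphere_measure)"

definition pseudo_dist :: "nat \<Rightarrow> 'a::euclidean_space set \<Rightarrow> 'a \<Rightarrow> ennreal" where
  "pseudo_dist m \<Omega> x =
     (let I = pseudo_dist_pow_inv m \<Omega> x in
      if I = 0 then \<infinity> else if I = \<infinity> then 0
      else ennreal (enn2real I powr (- 1 / real (2 * m))))"

end

theory Submission
  imports Defs "HOL-Probability.Distributions"
begin

text \<open>In one dimension, completing the square and iterating gives
  \<open>\<integral> |g\<^sup>(\<^sup>m\<^sup>)|\<^sup>2 \<ge> ((2m-1)!!)\<^sup>2 / 4\<^sup>m \<integral> |g|\<^sup>2 / |t - a|\<^sup>2\<^sup>m\<close> on every interval around a point \<open>a\<close> near which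
  \<open>g\<close> vanishes. Applied to the Voronoi cells of finitely many points of the complement of an open set,
  and letting these points become dense, it yields the inequality with the distance to the complement.
  Restricting to lines bounds \<open>\<integral> |f|\<^sup>2 / d\<^sub>y\<^sup>2\<^sup>m\<close> by \<open>\<integral> |\<partial>\<^sub>y\<^sup>m f|\<^sup>2\<close> for every vector \<open>y\<close>.

  Both sides are then averaged over a Gaussian \<open>y\<close> instead of over the sphere. Integrating by parts
  in \<open>x\<close> and in \<open>y\<close> shows that the average of \<open>\<integral> |\<partial>\<^sub>y\<^sup>m f|\<^sup>2\<close> is \<open>(2m-1)!! Q\<^sub>m(f)\<close>, while
  polar coordinates give \<open>N (N+2) \<cdots> (N+2m-2) a\<^sub>m(x)\<^sup>-\<^sup>2\<^sup>m\<close> for the average of \<open>d\<^sub>y(x)\<^sup>-\<^sup>2\<^sup>m\<close>.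
  The same representation of \<open>Q\<^sub>m\<close> makes it a convergent quantity along form-Cauchy sequences, and
  Fatou's lemma extends the inequality to the form domain.\<close>

section \<open>Directional derivatives of smooth functions\<close>

text \<open>A Gaussian may replace the sphere because \<open>dist_dir\<close> in a non-unit
  direction measures the line parameter, so the weight and the energy are both homogeneous of degree
  2m in \<open>y\<close>; the radial part then contributes only a moment. The gain is that
  integration by parts in \<open>y\<close> runs over the whole space, against a function whose
  derivative is a linear factor times itself. This takes the place of the Fourier identity saying
  that the mean of (y . xi)^(2m) is (2m-1)!! |xi|^(2m). With P = N(N+2)...(N+2m-2) and D = (2m-1)!!,
  the comparison of averages has constant P D^2 / 4^m against D, and the quotient P D / 4^m is the
  constant of the theorem. On a line, an open set can have infinitely many components. Finite point
  sets avoid treating these one by one, provided that the interval inequality tolerates nonzero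
  values at the ends of a cell. An element of the form domain is represented by test functions
  converging to it in L^2 and Cauchy for the form; the closed form is the limit of \<open>Qm\<close>
  along them.\<close>

lemma iter_pd_append: "iter_pd (bs @ cs) f = iter_pd bs (iter_pd cs f)"
  by (induction bs) auto

lemma smooth_fun_pd:
  assumes "smooth_fun f" "b \<in> Basis"
  shows "smooth_fun (pd b f)"
  unfolding smooth_fun_def
proof (intro allI impI)
  fix bs :: "'a list" and x assume "set bs \<subseteq> Basis"
  then have "iter_pd (bs @ [b]) f differentiable at x"
    using assms unfolding smooth_fun_def by auto
  then show "iter_pd bs (pd b f) differentiable at x"
    by (simp add: iter_pd_append)
qed

lemma smooth_fun_differentiable: "smooth_fun f \<Longrightarrow> f differentiable at x"
  unfolding smooth_fun_def by (metis empty_subsetI iter_pd.simps(1) list.set(1))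

lemma smooth_fun_continuous: "smooth_fun f \<Longrightarrow> continuous_on A f"
  by (simp add: continuous_at_imp_continuous_on differentiable_imp_continuous_within smooth_fun_differentiable)

lemma pd_lin:
  assumes "f differentiable at x" "g differentiable at x"
  shows "pd b (\<lambda>x. f x + c * g x) x = pd b f x + c * pd b g x"
proof -
  from assms have f: "(f has_derivative frechet_derivative f (at x)) (at x)"
    and g: "(g has_derivative frechet_derivative g (at x)) (at x)"
    by (simp_all add: frechet_derivative_works)
  have "((\<lambda>x. f x + c * g x) has_derivative
     (\<lambda>h. frechet_derivative f (at x) h + c * frechet_derivative g (at x) h)) (at x)"
    by (intro has_derivative_add has_derivative_mult_right f g)
  from frechet_derivative_at[OF this, symmetric] show ?thesis
    unfolding pd_def by (rule fun_cong)
qed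

lemma iter_pd_lin:
  assumes "smooth_fun f" "smooth_fun g" "set bs \<subseteq> Basis"
  shows "iter_pd bs (\<lambda>x. f x + c * g x) = (\<lambda>x. iter_pd bs f x + c * iter_pd bs g x)"
  using assms(3)
proof (induction bs)
  case (Cons b bs)
  then have "iter_pd bs f differentiable at x" "iter_pd bs g differentiable at x" for x
    using assms(1,2) unfolding smooth_fun_def by auto
  then have "pd b (\<lambda>x. iter_pd bs f x + c * iter_pd bs g x) x = pd b (iter_pd bs f) x + c * pd b (iter_pd bs g) x" for x
    by (intro pd_lin)
  moreover have "iter_pd bs (\<lambda>x. f x + c * g x) = (\<lambda>x. iter_pd bs f x + c * iter_pd bs g x)"
    using Cons.IH Cons.prems by simp
  ultimately show ?case
    unfolding iter_pd.simps by presburger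
qed simp

lemma smooth_fun_lin:
  assumes "smooth_fun f" "smooth_fun g"
  shows "smooth_fun (\<lambda>x. f x + c * g x)"
  unfolding smooth_fun_def
proof (intro allI impI)
  fix bs :: "'a list" and x assume bs: "set bs \<subseteq> Basis"
  then have "iter_pd bs f differentiable at x" "iter_pd bs g differentiable at x"
    using assms unfolding smooth_fun_def by auto
  then show "iter_pd bs (\<lambda>x. f x + c * g x) differentiable at x"
    unfolding iter_pd_lin[OF assms bs] by simp
qed

lemma smooth_fun_zero: "smooth_fun (\<lambda>x. 0)"
proof -
  have "iter_pd bs (\<lambda>x::'a. 0) = (\<lambda>x. 0)" for bs
  proof (induction bs)
    case (Cons b bs)
    then show ?case by (simp only: iter_pd.simps) (simp add: pd_def fun_eq_iff)
  qed simp
  then show ?thesis by (simp add: smooth_fun_def)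
qed

lemma smooth_fun_uminus: "smooth_fun f \<Longrightarrow> smooth_fun (\<lambda>x. - f x)"
  using smooth_fun_lin[OF smooth_fun_zero, of f "-1"] by simp

lemma smooth_fun_diff: "smooth_fun f \<Longrightarrow> smooth_fun g \<Longrightarrow> smooth_fun (\<lambda>x. f x - g x)"
  using smooth_fun_lin[of f g "-1"] by simp

lemma smooth_fun_sum:
  assumes "\<And>i. i \<in> I \<Longrightarrow> smooth_fun (F i)"
  shows "smooth_fun (\<lambda>x. \<Sum>i\<in>I. F i x)"
  using assms
proof (induction I rule: infinite_finite_induct)
  case (insert i I)
  then show ?case using smooth_fun_lin[of "F i" "\<lambda>x. \<Sum>i\<in>I. F i x" 1] by simp
qed (auto simp: smooth_fun_zero)

lemma smooth_fun_laplacian: "smooth_fun f \<Longrightarrow> smooth_fun (laplacian f)"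
  unfolding laplacian_def by (intro smooth_fun_sum smooth_fun_pd)

lemma has_vector_derivative_pd:
  assumes "f differentiable at (x + t *\<^sub>R y)"
  shows "((\<lambda>t. f (x + t *\<^sub>R y)) has_vector_derivative pd y f (x + t *\<^sub>R y)) (at t)"
proof -
  have f: "(f has_derivative frechet_derivative f (at (x + t *\<^sub>R y))) (at (x + t *\<^sub>R y))"
    using assms by (simp add: frechet_derivative_works)
  interpret bounded_linear "frechet_derivative f (at (x + t *\<^sub>R y))"
    using f by (rule has_derivative_bounded_linear)
  have "((\<lambda>t. x + t *\<^sub>R y) has_derivative (\<lambda>h. h *\<^sub>R y)) (at t)"
    by (auto intro!: derivative_eq_intros)
  from has_derivative_compose[OF this f] show ?thesis
    unfolding has_vector_derivative_def pd_def by (simp add: scale)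
qed

lemma pd_eq_sum:
  assumes "f differentiable at x"
  shows "pd y f x = (\<Sum>b\<in>Basis. of_real (y \<bullet> b) * pd b f x)"
proof -
  interpret bounded_linear "frechet_derivative f (at x)"
    using assms by (metis frechet_derivative_works has_derivative_bounded_linear)
  have "pd y f x = frechet_derivative f (at x) (\<Sum>b\<in>Basis. (y \<bullet> b) *\<^sub>R b)"
    by (simp add: pd_def euclidean_representation)
  then show ?thesis
    by (simp add: sum scale pd_def scaleR_conv_of_real)
qed

text \<open>The \<open>k\<close>-th directional derivative, written as a polynomial in the direction.\<close>

fun dder :: "'a::euclidean_space \<Rightarrow> nat \<Rightarrow> ('a \<Rightarrow> complex) \<Rightarrow> 'a \<Rightarrow> complex" where
  "dder y 0 f = f"
| "dder y (Suc k) f = (\<lambda>x. \<Sum>b\<in>Basis. of_real (y \<bullet> b) * dder y k (pd b f) x)"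

lemma dder_differentiable: "smooth_fun f \<Longrightarrow> dder y k f differentiable at x"
proof (induction k arbitrary: f)
  case 0
  then show ?case by (simp add: smooth_fun_differentiable)
next
  case (Suc k)
  then have "dder y k (pd b f) differentiable at x" if "b \<in> Basis" for b
    using that by (simp add: smooth_fun_pd)
  then show ?case by (auto intro!: differentiable_sum)
qed

lemma dder_continuous: "smooth_fun f \<Longrightarrow> continuous_on A (dder y k f)"
  by (simp add: continuous_at_imp_continuous_on differentiable_imp_continuous_within dder_differentiable)

text \<open>The recursion of \<open>dder\<close> applies its new partial derivative first; here the
  new derivative is applied last. Since \<open>y\<close> is fixed, the coefficients
  \<open>y \<bullet> b\<close> are constants, so induction over all \<open>f\<close> works without
  interchanging partial derivatives.\<close>

lemma pd_dder: "smooth_fun f \<Longrightarrow> pd y (dder y k f) x = dder y (Suc k) f x"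
proof (induction k arbitrary: f)
  case 0
  then show ?case by (simp add: pd_eq_sum smooth_fun_differentiable)
next
  case (Suc k)
  have "pd y (dder y (Suc k) f) x = (\<Sum>b\<in>Basis. of_real (y \<bullet> b) * pd y (dder y k (pd b f)) x)"
  proof -
    have d: "(dder y k (pd b f) has_derivative frechet_derivative (dder y k (pd b f)) (at x)) (at x)"
      if "b \<in> Basis" for b
      using dder_differentiable[OF smooth_fun_pd[OF Suc.prems that]] by (simp add: frechet_derivative_works)
    have "((\<lambda>x. \<Sum>b\<in>Basis. of_real (y \<bullet> b) * dder y k (pd b f) x) has_derivative
        (\<lambda>h. \<Sum>b\<in>Basis. of_real (y \<bullet> b) * frechet_derivative (dder y k (pd b f)) (at x) h)) (at x)"
      by (intro has_derivative_sum has_derivative_mult_right d)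
    from frechet_derivative_at[OF this] show ?thesis
      unfolding dder.simps by (metis (no_types, lifting) pd_def sum.cong)
  qed
  also have "\<dots> = dder y (Suc (Suc k)) f x"
    using Suc.IH[OF smooth_fun_pd[OF Suc.prems]] by simp
  finally show ?case .
qed

lemma dder_has_vector_derivative:
  assumes "smooth_fun f"
  shows "((\<lambda>t. dder y k f (x + t *\<^sub>R y)) has_vector_derivative dder y (Suc k) f (x + t *\<^sub>R y)) (at t)"
  using has_vector_derivative_pd[OF dder_differentiable[OF assms]] pd_dder[OF assms]
  by metis

text \<open>The increment f(x + s b + t c) - f(x + t c) is the integral of \<open>pd b f\<close>
  over the parameters from 0 to s. Differentiating at t = 0, once directly and once under the
  integral, and then at s = 0 yields the two orders of differentiation.\<close>

lemma pd_commute: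
  assumes f: "smooth_fun f" and b: "b \<in> Basis" and c: "c \<in> Basis"
  shows "pd b (pd c f) x = pd c (pd b f) x"
proof -
  define G where "G = (\<lambda>t u. pd b f (x + u *\<^sub>R b + t *\<^sub>R c))"
  define H where "H = (\<lambda>t u. pd c (pd b f) (x + u *\<^sub>R b + t *\<^sub>R c))"
  have sb: "smooth_fun (pd b f)" and scb: "smooth_fun (pd c (pd b f))" and sc: "smooth_fun (pd c f)"
    using f b c by (auto intro: smooth_fun_pd)
  have fd: "((\<lambda>u. f (x + u *\<^sub>R b + t *\<^sub>R c)) has_vector_derivative G t u) (at u)" for t u
    using has_vector_derivative_pd[of f "x + t *\<^sub>R c" u b] smooth_fun_differentiable[OF f]
    by (simp add: G_def algebra_simps)
  have ftc: "integral {0..s} (G t) = f (x + s *\<^sub>R b + t *\<^sub>R c) - f (x + t *\<^sub>R c)" if "0 \<le> s" for s t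
  proof -
    have "(G t has_integral (f (x + s *\<^sub>R b + t *\<^sub>R c) - f (x + 0 *\<^sub>R b + t *\<^sub>R c))) {0..s}"
      by (rule fundamental_theorem_of_calculus[OF that])
         (auto intro: fd has_vector_derivative_at_within)
    then show ?thesis by (simp add: integral_unique)
  qed
  have contH: "continuous_on A (H t)" for A t
    unfolding H_def by (rule continuous_on_compose2[OF smooth_fun_continuous[OF scb, of UNIV]])
      (auto intro!: continuous_intros)
  have contG: "continuous_on A (G t)" for A t
    unfolding G_def by (rule continuous_on_compose2[OF smooth_fun_continuous[OF sb, of UNIV]])
      (auto intro!: continuous_intros)
  have leib: "((\<lambda>t. integral (cbox 0 s) (G t)) has_vector_derivative integral (cbox 0 s) (H 0)) (at 0 within UNIV)"
    for s
  proof (rule leibniz_rule_vector_derivative)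
    show "((\<lambda>t. G t u) has_vector_derivative H t u) (at t within UNIV)" for t u
      using has_vector_derivative_pd[of "pd b f" "x + u *\<^sub>R b" t c] smooth_fun_differentiable[OF sb]
      by (simp add: G_def H_def)
    show "G t integrable_on cbox 0 s" for t
      using contG by (intro integrable_continuous) auto
    show "continuous_on (UNIV \<times> cbox 0 s) (\<lambda>(x, t). H x t)"
      unfolding H_def case_prod_beta
      by (rule continuous_on_compose2[OF smooth_fun_continuous[OF scb, of UNIV]])
        (auto intro!: continuous_intros)
  qed auto
  have I: "integral {0..s} (H 0) = pd c f (x + s *\<^sub>R b) - pd c f x" if "0 \<le> s" for s
  proof -
    have "((\<lambda>t. f (x + s *\<^sub>R b + t *\<^sub>R c) - f (x + t *\<^sub>R c)) has_vector_derivative integral {0..s} (H 0)) (at 0)"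
      using leib[of s] unfolding box_real ftc[OF that] .
    moreover have "((\<lambda>t. f (x + s *\<^sub>R b + t *\<^sub>R c) - f (x + t *\<^sub>R c)) has_vector_derivative
        (pd c f (x + s *\<^sub>R b) - pd c f x)) (at 0)"
      using has_vector_derivative_pd[of f "x + s *\<^sub>R b" 0 c, OF smooth_fun_differentiable[OF f]]
        has_vector_derivative_pd[of f x 0 c, OF smooth_fun_differentiable[OF f]]
      by (intro has_vector_derivative_diff) (simp_all only: scaleR_zero_left add_0_right)
    ultimately show ?thesis by (rule vector_derivative_unique_at)
  qed
  \<comment> \<open>The increment formula is available for s \<ge> 0 only, so the two derivatives in
    s are compared from the right.\<close>
  have "((\<lambda>s. integral {0..s} (H 0)) has_vector_derivative H 0 0) (at 0 within {0..1})"
    by (rule integral_has_vector_derivative[OF contH]) auto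
  then have 1: "((\<lambda>s. pd c f (x + s *\<^sub>R b) - pd c f x) has_vector_derivative H 0 0) (at 0 within {0..1})"
    by (rule has_vector_derivative_transform[rotated 2]) (auto simp: I)
  have "((\<lambda>s. pd c f (x + s *\<^sub>R b)) has_vector_derivative pd b (pd c f) x) (at 0)"
    using has_vector_derivative_pd[of "pd c f" x 0 b, OF smooth_fun_differentiable[OF sc]]
    by (simp only: scaleR_zero_left add_0_right)
  then have "((\<lambda>s. pd c f (x + s *\<^sub>R b) - pd c f x) has_vector_derivative pd b (pd c f) x) (at 0)"
    unfolding diff_conv_add_uminus has_vector_derivative_add_const .
  then have 2: "((\<lambda>s. pd c f (x + s *\<^sub>R b) - pd c f x) has_vector_derivative pd b (pd c f) x) (at 0 within {0..1})"
    by (rule has_vector_derivative_at_within)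
  have "H 0 0 = pd b (pd c f) x"
    by (rule vector_derivative_unique_within[OF _ 1 2])
      (simp add: at_within_Icc_at_right)
  then show ?thesis by (simp add: H_def)
qed

section \<open>The one-dimensional Hardy--Rellich inequality\<close>

text \<open>Where h can be nonzero, |t - a| equals max \<delta> |t - a|, which never vanishes.
  Multiplying numerator and denominator by (t - a)^n first makes the exponent in the denominator
  even, so the absolute value does no harm to the sign.\<close>

lemma continuous_on_divide_vanishing:
  fixes h :: "real \<Rightarrow> real"
  assumes h: "continuous_on UNIV h" and "\<delta> > 0" and van: "\<And>t. \<bar>t - a\<bar> < \<delta> \<Longrightarrow> h t = 0"
  shows "continuous_on A (\<lambda>t. h t / (t - a) ^ n)"
proof -
  have eq: "h t / (t - a) ^ n = h t * (t - a) ^ n / (max \<delta> \<bar>t - a\<bar>) ^ (2 * n)" for t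
  proof (cases "\<bar>t - a\<bar> < \<delta>")
    case False
    then have "max \<delta> \<bar>t - a\<bar> ^ (2 * n) = (t - a) ^ n * (t - a) ^ n"
      by (simp add: max_def power_mult power_mult_distrib[symmetric] power2_eq_square)
    moreover have "t - a \<noteq> 0" using False \<open>\<delta> > 0\<close> by auto
    ultimately show ?thesis by simp
  qed (simp add: van)
  have "max \<delta> \<bar>t - a\<bar> \<noteq> 0" for t using \<open>\<delta> > 0\<close> by (auto simp: max_def)
  then show ?thesis
    unfolding eq by (intro continuous_intros continuous_on_subset[OF h]) auto
qed

lemma has_real_derivative_cmod_power2:
  assumes "(g has_vector_derivative g') (at t)"
  shows "((\<lambda>t. (cmod (g t))\<^sup>2) has_real_derivative 2 * Re (g' * cnj (g t))) (at t)"
proof -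
  have re: "((\<lambda>t. Re (g t)) has_real_derivative Re g') (at t)"
    unfolding has_real_derivative_iff_has_vector_derivative
    by (rule bounded_linear.has_vector_derivative[OF bounded_linear_Re assms])
  have im: "((\<lambda>t. Im (g t)) has_real_derivative Im g') (at t)"
    unfolding has_real_derivative_iff_has_vector_derivative
    by (rule bounded_linear.has_vector_derivative[OF bounded_linear_Im assms])
  from DERIV_add[OF DERIV_power[OF re, of 2] DERIV_power[OF im, of 2]] show ?thesis
    unfolding cmod_power2 by (simp add: algebra_simps)
qed

text \<open>Expand |w - (c / \<tau>) z|^2 \<ge> 0 and divide by the even power of \<tau>. The left
  side is arranged to be the derivative of c |g|^2 / \<tau>^(2k+1) when w = g', z = g and 2c = 2k +
  1.\<close>

lemma hardy_pointwise:
  fixes z w :: complex and \<tau> :: real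
  assumes "\<tau> \<noteq> 0"
  shows "2 * c * Re (w * cnj z) / \<tau> ^ (2 * k + 1) - 2 * c\<^sup>2 * (cmod z)\<^sup>2 / \<tau> ^ (2 * k + 2)
    \<le> (cmod w)\<^sup>2 / \<tau> ^ (2 * k) - c\<^sup>2 * (cmod z)\<^sup>2 / \<tau> ^ (2 * k + 2)"
proof -
  have "0 \<le> (cmod (w - of_real (c / \<tau>) * z))\<^sup>2" by simp
  also have "\<dots> = (cmod w)\<^sup>2 - 2 * (c / \<tau>) * Re (w * cnj z) + (c / \<tau>)\<^sup>2 * (cmod z)\<^sup>2"
    unfolding cmod_power2 by (simp add: algebra_simps power2_eq_square)
  finally have "0 \<le> ((cmod w)\<^sup>2 - 2 * (c / \<tau>) * Re (w * cnj z) + (c / \<tau>)\<^sup>2 * (cmod z)\<^sup>2) / \<tau> ^ (2 * k)"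
    by (intro divide_nonneg_nonneg) (auto simp: power_mult)
  also have "\<dots> = (cmod w)\<^sup>2 / \<tau> ^ (2 * k) - 2 * c * Re (w * cnj z) / \<tau> ^ (2 * k + 1)
      + c\<^sup>2 * (cmod z)\<^sup>2 / \<tau> ^ (2 * k + 2)"
    using assms by (simp add: field_simps power2_eq_square)
  finally show ?thesis by simp
qed

text \<open>The weight \<open>1 / (t - a) ^ (2 * k + 1)\<close> changes sign at \<open>a\<close>, so that the boundary terms at
  both ends of an interval around \<open>a\<close> have the favourable sign.\<close>

lemma hardy_step:
  fixes g g' :: "real \<Rightarrow> complex"
  assumes deriv: "\<And>t. (g has_vector_derivative g' t) (at t)" and cont: "continuous_on UNIV g'"
    and "\<delta> > 0" and van: "\<And>t. \<bar>t - a\<bar> < \<delta> \<Longrightarrow> g t = 0" "\<And>t. \<bar>t - a\<bar> < \<delta> \<Longrightarrow> g' t = 0"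
    and "l \<le> a" "a \<le> u"
  shows "((2 * real k + 1) / 2)\<^sup>2 * integral {l..u} (\<lambda>t. (cmod (g t))\<^sup>2 / (t - a) ^ (2 * Suc k))
    \<le> integral {l..u} (\<lambda>t. (cmod (g' t))\<^sup>2 / (t - a) ^ (2 * k))"
proof -
  \<comment> \<open>With 2c = 2k + 1, differentiating the weight in \<open>G\<close> gives the
    coefficient 2 c^2 that \<open>hardy_pointwise\<close> expects. This value also maximises (2k +
    1) c - c^2, the constant that completing the square leaves over.\<close>
  define c where "c = (2 * real k + 1) / 2"
  define G where "G = (\<lambda>t. c * ((cmod (g t))\<^sup>2 / (t - a) ^ (2 * k + 1)))"
  define G' where "G' = (\<lambda>t. 2 * c * Re (g' t * cnj (g t)) / (t - a) ^ (2 * k + 1)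
      - 2 * c\<^sup>2 * (cmod (g t))\<^sup>2 / (t - a) ^ (2 * k + 2))"
  define p where "p = (\<lambda>t. (cmod (g' t))\<^sup>2 / (t - a) ^ (2 * k) - c\<^sup>2 * ((cmod (g t))\<^sup>2 / (t - a) ^ (2 * k + 2)))"
  have contg: "continuous_on UNIV g"
    using deriv by (auto intro!: continuous_at_imp_continuous_on has_vector_derivative_continuous)
  have G: "(G has_real_derivative G' t) (at t)" for t
  proof (cases "t = a")
    case True
    have "(G has_real_derivative 0) (at t)"
      by (rule has_field_derivative_transform_within[of "\<lambda>_. 0", OF _ \<open>\<delta> > 0\<close>])
        (use van True in \<open>auto simp: G_def dist_real_def\<close>)
    then show ?thesis using van[of t] True \<open>\<delta> > 0\<close> by (simp add: G'_def)
  next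
    case False
    have "((\<lambda>t. (cmod (g t))\<^sup>2 / (t - a) ^ (2 * k + 1)) has_real_derivative
      (2 * Re (g' t * cnj (g t)) * (t - a) ^ (2 * k + 1)
        - (cmod (g t))\<^sup>2 * (real (2 * k + 1) * (t - a) ^ (2 * k))) / ((t - a) ^ (2 * k + 1) * (t - a) ^ (2 * k + 1))) (at t)"
    proof (rule DERIV_divide[OF has_real_derivative_cmod_power2[OF deriv]])
      show "((\<lambda>t. (t - a) ^ (2 * k + 1)) has_real_derivative real (2 * k + 1) * (t - a) ^ (2 * k)) (at t)"
        by (rule derivative_eq_intros refl)+ simp
    qed (use False in simp)
    from DERIV_cmult[OF this, of c] have "(G has_real_derivative
      c * ((2 * Re (g' t * cnj (g t)) * (t - a) ^ (2 * k + 1)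
        - (cmod (g t))\<^sup>2 * (real (2 * k + 1) * (t - a) ^ (2 * k))) / ((t - a) ^ (2 * k + 1) * (t - a) ^ (2 * k + 1)))) (at t)"
      by (simp only: G_def)
    also have "c * ((2 * Re (g' t * cnj (g t)) * (t - a) ^ (2 * k + 1)
        - (cmod (g t))\<^sup>2 * (real (2 * k + 1) * (t - a) ^ (2 * k))) / ((t - a) ^ (2 * k + 1) * (t - a) ^ (2 * k + 1))) = G' t"
    proof -
      define \<tau> where "\<tau> = t - a"
      have "\<tau> \<noteq> 0" using False by (simp add: \<tau>_def)
      have c: "real (2 * k + 1) = 2 * c" by (simp add: c_def)
      have "c * ((2 * r * \<tau> ^ (2 * k + 1) - s * (2 * c * \<tau> ^ (2 * k))) / (\<tau> ^ (2 * k + 1) * \<tau> ^ (2 * k + 1)))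
        = 2 * c * r / \<tau> ^ (2 * k + 1) - 2 * c\<^sup>2 * s / \<tau> ^ (2 * k + 2)" for r s
        using \<open>\<tau> \<noteq> 0\<close> by (simp add: field_simps power2_eq_square)
      from this[of "Re (g' t * cnj (g t))" "(cmod (g t))\<^sup>2"] show ?thesis unfolding G'_def c \<tau>_def by (simp only: mult_ac)
    qed
    finally show ?thesis .
  qed
  have "(G' has_integral (G u - G l)) {l..u}"
    using G \<open>l \<le> a\<close> \<open>a \<le> u\<close>
    by (intro fundamental_theorem_of_calculus)
      (auto simp: has_real_derivative_iff_has_vector_derivative intro: has_vector_derivative_at_within)
  then have I1: "G' integrable_on {l..u}" "integral {l..u} G' = G u - G l"
    by (auto simp: integral_unique)
  have c1: "continuous_on {l..u} (\<lambda>t. (cmod (g' t))\<^sup>2 / (t - a) ^ (2 * k))"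
    by (rule continuous_on_divide_vanishing[OF _ \<open>\<delta> > 0\<close>]) (auto intro!: continuous_intros cont simp: van)
  have c2: "continuous_on {l..u} (\<lambda>t. (cmod (g t))\<^sup>2 / (t - a) ^ (2 * k + 2))"
    by (rule continuous_on_divide_vanishing[OF _ \<open>\<delta> > 0\<close>]) (auto intro!: continuous_intros contg simp: van)
  have le: "G' t \<le> p t" for t
    using hardy_pointwise[of "t - a" c "g' t" "g t" k] van[of t] \<open>\<delta> > 0\<close>
    by (cases "t = a") (auto simp: G'_def p_def)
  have i1: "(\<lambda>t. (cmod (g' t))\<^sup>2 / (t - a) ^ (2 * k)) integrable_on {l..u}"
    using c1 by (rule integrable_continuous_real)
  have i2: "(\<lambda>t. c\<^sup>2 * ((cmod (g t))\<^sup>2 / (t - a) ^ (2 * k + 2))) integrable_on {l..u}"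
    by (intro integrable_continuous_real continuous_on_mult continuous_on_const c2)
  have "(l - a) ^ (2 * k + 1) \<le> 0"
    using \<open>l \<le> a\<close> by (simp add: power_le_zero_eq mult_nonpos_nonneg)
  then have "G l \<le> 0"
    unfolding G_def c_def by (intro mult_nonneg_nonpos divide_nonneg_nonpos) auto
  moreover have "0 \<le> G u"
    unfolding G_def c_def using \<open>a \<le> u\<close> by (intro mult_nonneg_nonneg divide_nonneg_nonneg zero_le_power) auto
  ultimately have "0 \<le> integral {l..u} G'" using I1 by simp
  also have "\<dots> \<le> integral {l..u} p"
    using le integrable_diff[OF i1 i2] by (intro integral_le[OF I1(1)]) (simp_all only: p_def)
  also have "\<dots> = integral {l..u} (\<lambda>t. (cmod (g' t))\<^sup>2 / (t - a) ^ (2 * k))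
      - c\<^sup>2 * integral {l..u} (\<lambda>t. (cmod (g t))\<^sup>2 / (t - a) ^ (2 * k + 2))"
    unfolding p_def integral_diff[OF i1 i2] integral_mult_right ..
  finally show ?thesis by (simp add: c_def)
qed

definition hardy_const :: "nat \<Rightarrow> real" where
  "hardy_const m = (\<Prod>k<m. ((2 * real k + 1) / 2)\<^sup>2)"

lemma hardy_const_nonneg: "0 \<le> hardy_const m"
  unfolding hardy_const_def by (intro prod_nonneg) auto

text \<open>Each use of \<open>hardy_step\<close> trades one derivative for two powers of the
  weight, so the induction runs over the number j of derivatives already removed. The functions may
  be nonzero at l and u, which is what permits cutting the line into cells.\<close>

lemma hardy_interval:
  fixes g :: "nat \<Rightarrow> real \<Rightarrow> complex"
  assumes deriv: "\<And>k t. (g k has_vector_derivative g (Suc k) t) (at t)"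
    and "\<delta> > 0" and van: "\<And>k t. \<bar>t - a\<bar> < \<delta> \<Longrightarrow> g k t = 0"
    and "l \<le> a" "a \<le> u"
  shows "hardy_const m * integral {l..u} (\<lambda>t. (cmod (g 0 t))\<^sup>2 / (t - a) ^ (2 * m))
    \<le> integral {l..u} (\<lambda>t. (cmod (g m t))\<^sup>2)"
proof -
  have cont: "continuous_on UNIV (g k)" for k
    using deriv[of k] by (auto intro!: continuous_at_imp_continuous_on has_vector_derivative_continuous)
  have "hardy_const j * integral {l..u} (\<lambda>t. (cmod (g (m - j) t))\<^sup>2 / (t - a) ^ (2 * j))
    \<le> integral {l..u} (\<lambda>t. (cmod (g m t))\<^sup>2)" if "j \<le> m" for j
    using that
  proof (induction j)
    case (Suc j)
    then have eq: "Suc (m - Suc j) = m - j" by simp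
    have "hardy_const (Suc j) * integral {l..u} (\<lambda>t. (cmod (g (m - Suc j) t))\<^sup>2 / (t - a) ^ (2 * Suc j))
      = hardy_const j * (((2 * real j + 1) / 2)\<^sup>2 * integral {l..u} (\<lambda>t. (cmod (g (m - Suc j) t))\<^sup>2 / (t - a) ^ (2 * Suc j)))"
      by (simp add: hardy_const_def)
    also have "\<dots> \<le> hardy_const j * integral {l..u} (\<lambda>t. (cmod (g (m - j) t))\<^sup>2 / (t - a) ^ (2 * j))"
    proof (rule mult_left_mono[OF hardy_step[where \<delta>=\<delta>]])
      show "(g (m - Suc j) has_vector_derivative g (m - j) t) (at t)" for t
        using deriv[of "m - Suc j"] by (simp only: eq)
    qed (use cont van assms hardy_const_nonneg in auto)
    also have "\<dots> \<le> integral {l..u} (\<lambda>t. (cmod (g m t))\<^sup>2)"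
      using Suc by simp
    finally show ?case .
  qed (simp add: hardy_const_def)
  from this[of m] show ?thesis by simp
qed

section \<open>Voronoi cells on the line and the distance to the complement of an open set\<close>

lemma voronoi_cell_interval:
  fixes F :: "real set"
  assumes "a \<in> {-R..R}"
  obtains l u where "l \<le> a" "a \<le> u" "{t\<in>{-R..R}. \<forall>b\<in>F. \<bar>t - a\<bar> \<le> \<bar>t - b\<bar>} = {l..u}"
proof -
  \<comment> \<open>After squaring, the quadratic terms cancel and each comparison is affine in
    \<open>t\<close>. The cell is therefore compact and convex, and the points of \<open>F\<close>
    need not be sorted.\<close>
  have "\<bar>t - a\<bar> \<le> \<bar>t - b\<bar> \<longleftrightarrow> (2 * (b - a)) \<bullet> t \<le> b\<^sup>2 - a\<^sup>2" for t b
    unfolding abs_le_square_iff by (simp add: power2_eq_square algebra_simps)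
  then have eq: "{t\<in>{-R..R}. \<forall>b\<in>F. \<bar>t - a\<bar> \<le> \<bar>t - b\<bar>}
      = {-R..R} \<inter> (\<Inter>b\<in>F. {t. (2 * (b - a)) \<bullet> t \<le> b\<^sup>2 - a\<^sup>2})" (is "?V = _")
    by auto
  have "compact ?V"
    unfolding eq by (intro compact_Int_closed closed_INT ballI closed_halfspace_le compact_Icc)
  moreover have "convex ?V"
    unfolding eq by (intro convex_Int convex_INT convex_halfspace_le) auto
  ultimately have "connected ?V \<and> compact ?V" by (simp add: convex_connected)
  then obtain l u where lu: "?V = {l..u}"
    unfolding connected_compact_interval_1 by (elim exE)
  moreover have "a \<in> ?V" using assms by simp
  ultimately have "a \<in> {l..u}" by simp
  then show ?thesis using that[of l u] lu by simp
qed

text \<open>On the cell of \<open>a\<close> the distance to \<open>F\<close> is |t - a|, so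
  \<open>hardy_interval\<close> applies cell by cell. The sum loses nothing because the cells cover
  the support of \<open>g 0\<close> and overlap only in a null set.\<close>

lemma hardy_finite:
  fixes g :: "nat \<Rightarrow> real \<Rightarrow> complex"
  assumes deriv: "\<And>k t. (g k has_vector_derivative g (Suc k) t) (at t)"
    and F: "finite F" "F \<noteq> {}"
    and van: "\<And>a. a \<in> F \<Longrightarrow> \<exists>\<delta>>0. \<forall>k t. \<bar>t - a\<bar> < \<delta> \<longrightarrow> g k t = 0"
    and supp: "bounded {t. g 0 t \<noteq> 0}"
  shows "ennreal (hardy_const m) * (\<integral>\<^sup>+t. ennreal ((cmod (g 0 t))\<^sup>2 / (infdist t F) ^ (2 * m)) \<partial>lborel)
    \<le> (\<integral>\<^sup>+t. ennreal ((cmod (g m t))\<^sup>2) \<partial>lborel)"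
proof -
  have cont: "continuous_on UNIV (g k)" for k
    using deriv[of k] by (auto intro!: continuous_at_imp_continuous_on has_vector_derivative_continuous)
  have [measurable]: "g k \<in> borel_measurable borel" for k
    using cont by (rule borel_measurable_continuous_onI)
  from F supp have "bounded (F \<union> {t. g 0 t \<noteq> 0})"
    by (simp add: finite_imp_bounded)
  \<comment> \<open>The bound has to cover \<open>F\<close>, so that each cell contains its own
    point, and the support of \<open>g 0\<close>, so that the truncated cells cover it.\<close>
  then obtain R where R: "\<And>t. t \<in> F \<union> {t. g 0 t \<noteq> 0} \<Longrightarrow> \<bar>t\<bar> \<le> R"
    unfolding bounded_iff by auto
  define V where "V a = {t\<in>{-R..R}. \<forall>b\<in>F. \<bar>t - a\<bar> \<le> \<bar>t - b\<bar>}" for a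
  have "\<exists>l u. l \<le> a \<and> a \<le> u \<and> V a = {l..u}" if "a \<in> F" for a
  proof -
    have "a \<in> {-R..R}" using R[of a] that by (simp add: abs_le_iff)
    then obtain l u where "l \<le> a" "a \<le> u" "V a = {l..u}"
      unfolding V_def by (rule voronoi_cell_interval)
    then show ?thesis by blast
  qed
  note lu = this
  have Vm: "V a \<in> sets borel" if "a \<in> F" for a using lu[OF that] by auto
  have cell: "ennreal (hardy_const m) * (\<integral>\<^sup>+t. ennreal ((cmod (g 0 t))\<^sup>2 / (t - a) ^ (2 * m)) * indicator (V a) t \<partial>lborel)
      \<le> (\<integral>\<^sup>+t. ennreal ((cmod (g m t))\<^sup>2) * indicator (V a) t \<partial>lborel)" if a: "a \<in> F" for a
  proof -
    from lu[OF a] obtain l u where lu: "l \<le> a" "a \<le> u" "V a = {l..u}" by blast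
    from van[OF a] obtain \<delta> where \<delta>: "\<delta> > 0" "\<And>k t. \<bar>t - a\<bar> < \<delta> \<Longrightarrow> g k t = 0" by blast
    have h: "hardy_const m * integral {l..u} (\<lambda>t. (cmod (g 0 t))\<^sup>2 / (t - a) ^ (2 * m))
      \<le> integral {l..u} (\<lambda>t. (cmod (g m t))\<^sup>2)"
      by (rule hardy_interval[of g \<delta> a]) (use deriv \<delta> lu in auto)
    have "continuous_on {l..u} (\<lambda>t. (cmod (g 0 t))\<^sup>2 / (t - a) ^ (2 * m))"
      by (rule continuous_on_divide_vanishing[OF _ \<open>\<delta> > 0\<close>]) (auto intro!: continuous_intros cont simp: \<delta>)
    then have i0: "(\<integral>\<^sup>+t. ennreal ((cmod (g 0 t))\<^sup>2 / (t - a) ^ (2 * m)) * indicator {l..u} t \<partial>lborel)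
        = ennreal (integral {l..u} (\<lambda>t. (cmod (g 0 t))\<^sup>2 / (t - a) ^ (2 * m)))"
      by (intro nn_integral_has_integral_lebesgue' integrable_integral integrable_continuous_real) auto
    have "continuous_on {l..u} (\<lambda>t. (cmod (g m t))\<^sup>2)"
      by (intro continuous_intros continuous_on_subset[OF cont]) auto
    then have i1: "(\<integral>\<^sup>+t. ennreal ((cmod (g m t))\<^sup>2) * indicator {l..u} t \<partial>lborel)
        = ennreal (integral {l..u} (\<lambda>t. (cmod (g m t))\<^sup>2))"
      by (intro nn_integral_has_integral_lebesgue' integrable_integral integrable_continuous_real) auto
    show ?thesis
      using h by (simp add: lu(3)) (simp add: i0 i1 ennreal_mult'[symmetric] hardy_const_nonneg ennreal_leI)
  qed
  have pw: "ennreal ((cmod (g 0 t))\<^sup>2 / (infdist t F) ^ (2 * m))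
      \<le> (\<Sum>a\<in>F. ennreal ((cmod (g 0 t))\<^sup>2 / (t - a) ^ (2 * m)) * indicator (V a) t)" for t
  proof (cases "g 0 t = 0")
    case False
    obtain a where a: "a \<in> F" "infdist t F = dist t a"
      using infdist_attains_inf[OF finite_imp_closed[OF F(1)] F(2)] by blast
    have "\<bar>t - a\<bar> \<le> \<bar>t - b\<bar>" if "b \<in> F" for b
      using infdist_le[OF that, of t] a(2) by (simp add: dist_real_def)
    moreover have "\<bar>t\<bar> \<le> R" using R[of t] False by simp
    ultimately have "t \<in> V a" by (auto simp: V_def)
    then have "ennreal ((cmod (g 0 t))\<^sup>2 / (infdist t F) ^ (2 * m))
      = ennreal ((cmod (g 0 t))\<^sup>2 / (t - a) ^ (2 * m)) * indicator (V a) t"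
      using a(2) by (simp add: dist_real_def power_mult)
    also have "\<dots> \<le> (\<Sum>a\<in>F. ennreal ((cmod (g 0 t))\<^sup>2 / (t - a) ^ (2 * m)) * indicator (V a) t)"
      by (rule member_le_sum[OF a(1)]) (use F in auto)
    finally show ?thesis .
  qed simp
  \<comment> \<open>Cells of two different points can meet only at their midpoint. Off these
    finitely many points at most one indicator in the sum is 1.\<close>
  have "AE t in lborel. t \<notin> (\<lambda>(a, b). (a + b) / 2) ` (F \<times> F)"
    by (intro AE_not_in finite_imp_null_set_lborel finite_imageI finite_cartesian_product F)
  then have ov: "AE t in lborel. (\<Sum>a\<in>F. ennreal ((cmod (g m t))\<^sup>2) * indicator (V a) t) \<le> ennreal ((cmod (g m t))\<^sup>2)"
  proof eventually_elim
    case (elim t)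
    have "a = b" if "a \<in> F" "b \<in> F" "t \<in> V a" "t \<in> V b" for a b
    proof (rule ccontr)
      assume "a \<noteq> b"
      moreover have "\<bar>t - a\<bar> \<le> \<bar>t - b\<bar>" "\<bar>t - b\<bar> \<le> \<bar>t - a\<bar>"
        using that by (simp_all add: V_def)
      ultimately have "t - a = - (t - b)" by (auto dest!: antisym simp: abs_eq_iff)
      then have "t = (a + b) / 2" by simp
      then have "t \<in> (\<lambda>(a, b). (a + b) / 2) ` (F \<times> F)"
        using that by (intro image_eqI[of _ _ "(a, b)"]) auto
      then show False using elim by contradiction
    qed
    then have "{a\<in>F. t \<in> V a} = {} \<or> (\<exists>a. {a\<in>F. t \<in> V a} = {a})" by blast
    moreover have "(\<Sum>a\<in>F. ennreal ((cmod (g m t))\<^sup>2) * indicator (V a) t)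
        = (\<Sum>a\<in>{a\<in>F. t \<in> V a}. ennreal ((cmod (g m t))\<^sup>2))"
      using F by (intro sum.mono_neutral_cong_right) (auto simp: indicator_def)
    ultimately show ?case by auto
  qed
  have "ennreal (hardy_const m) * (\<integral>\<^sup>+t. ennreal ((cmod (g 0 t))\<^sup>2 / (infdist t F) ^ (2 * m)) \<partial>lborel)
    \<le> ennreal (hardy_const m) * (\<integral>\<^sup>+t. (\<Sum>a\<in>F. ennreal ((cmod (g 0 t))\<^sup>2 / (t - a) ^ (2 * m)) * indicator (V a) t) \<partial>lborel)"
    by (intro mult_left_mono nn_integral_mono pw) auto
  also have "\<dots> = (\<Sum>a\<in>F. ennreal (hardy_const m) * (\<integral>\<^sup>+t. ennreal ((cmod (g 0 t))\<^sup>2 / (t - a) ^ (2 * m)) * indicator (V a) t \<partial>lborel))"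
    using Vm by (subst nn_integral_sum) (auto simp: sum_distrib_left)
  also have "\<dots> \<le> (\<Sum>a\<in>F. (\<integral>\<^sup>+t. ennreal ((cmod (g m t))\<^sup>2) * indicator (V a) t \<partial>lborel))"
    by (intro sum_mono cell)
  also have "\<dots> = (\<integral>\<^sup>+t. (\<Sum>a\<in>F. ennreal ((cmod (g m t))\<^sup>2) * indicator (V a) t) \<partial>lborel)"
    using Vm by (subst nn_integral_sum) auto
  also have "\<dots> \<le> (\<integral>\<^sup>+t. ennreal ((cmod (g m t))\<^sup>2) \<partial>lborel)"
    by (rule nn_integral_mono_AE[OF ov])
  finally show ?thesis .
qed

text \<open>Substitute a = t + s. The complement has to be nonempty: \<open>infdist\<close> to the
  empty set is 0, whereas \<open>dist_dir\<close> is then top.\<close>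

lemma dist_dir_real:
  fixes U :: "real set"
  assumes "U \<noteq> UNIV"
  shows "dist_dir U 1 t = ennreal (infdist t (- U))"
proof -
  have ne: "- U \<noteq> {}" using assms by auto
  have "{s. t + s *\<^sub>R 1 \<notin> U} = (\<lambda>a. a - t) ` (- U)"
    by (auto simp: image_iff intro!: bexI[of _ "t + _"])
  then have "dist_dir U 1 t = (INF a\<in>-U. ennreal (dist t a))"
    unfolding dist_dir_def by (simp add: image_image dist_real_def abs_minus_commute)
  also have "\<dots> = ennreal (INF a\<in>-U. dist t a)"
  proof (rule antisym)
    show "(INF a\<in>-U. ennreal (dist t a)) \<le> ennreal (INF a\<in>-U. dist t a)"
    proof (rule ennreal_le_epsilon)
      fix e :: real assume "0 < e"
      have "bdd_below (dist t ` (- U))" by (rule bdd_belowI[of _ 0]) auto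
      with \<open>0 < e\<close> obtain a where "a \<in> - U" "dist t a < (INF a\<in>-U. dist t a) + e"
        using cINF_less_iff[OF ne, of "dist t" "(INF a\<in>-U. dist t a) + e"] by auto
      then have "(INF a\<in>-U. ennreal (dist t a)) \<le> ennreal ((INF a\<in>-U. dist t a) + e)"
        by (intro INF_lower2[of a] ennreal_leI) auto
      also have "\<dots> = ennreal (INF a\<in>-U. dist t a) + ennreal e"
        using \<open>0 < e\<close> ne by (intro ennreal_plus cINF_greatest) auto
      finally show "(INF a\<in>-U. ennreal (dist t a)) \<le> ennreal (INF a\<in>-U. dist t a) + ennreal e" .
    qed
    show "ennreal (INF a\<in>-U. dist t a) \<le> (INF a\<in>-U. ennreal (dist t a))"
      by (intro INF_greatest ennreal_leI cINF_lower bdd_belowI[of _ 0]) auto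
  qed
  also have "\<dots> = ennreal (infdist t (- U))"
    using ne by (simp add: infdist_notempty)
  finally show ?thesis .
qed

lemma infdist_increasing_tendsto:
  fixes F :: "nat \<Rightarrow> real set"
  assumes "incseq F" "F 0 \<noteq> {}" "\<And>n. F n \<subseteq> C" "C \<subseteq> closure (\<Union>n. F n)"
  shows "(\<lambda>n. infdist t (F n)) \<longlonglongrightarrow> infdist t C"
proof (rule LIMSEQ_I)
  fix e :: real assume "0 < e"
  have ne: "F n \<noteq> {}" for n using assms(1,2) by (metis incseq_def le0 subset_empty)
  then have neC: "C \<noteq> {}" using assms(3) by blast
  have "(INF a\<in>C. dist t a) < infdist t C + e / 2" using \<open>0 < e\<close> neC by (simp add: infdist_notempty)
  moreover have "bdd_below (dist t ` C)" by (rule bdd_belowI[of _ 0]) auto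
  ultimately obtain c where c: "c \<in> C" "dist t c < infdist t C + e / 2"
    using cINF_less_iff[OF neC, of "dist t"] by blast
  then have "c \<in> closure (\<Union>n. F n)" using assms(4) by blast
  then have "\<exists>a\<in>(\<Union>n. F n). dist a c < e / 2"
    unfolding closure_approachable using \<open>0 < e\<close> half_gt_zero by blast
  then obtain n a where a: "a \<in> F n" "dist a c < e / 2" by blast
  have "norm (infdist t (F k) - infdist t C) < e" if "k \<ge> n" for k
  proof -
    have "a \<in> F k" using a(1) assms(1) that by (auto simp: incseq_def)
    then have "infdist t (F k) \<le> dist t a" by (rule infdist_le)
    also have "\<dots> < infdist t C + e" using c a dist_triangle[of t a c] by (simp add: dist_commute)
    finally show ?thesis using infdist_mono[OF assms(3) ne, of t k] by simp
  qed
  then show "\<exists>no. \<forall>n\<ge>no. norm (infdist t (F n) - infdist t C) < e" by blast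
qed

text \<open>The finite sets exhaust a countable dense subset of the complement. Their points all
  have a neighbourhood that misses \<open>K\<close>, as \<open>hardy_finite\<close> requires, and
  Fatou's lemma carries the bound to the limit of the weights.\<close>

lemma hardy_open:
  fixes g :: "nat \<Rightarrow> real \<Rightarrow> complex"
  assumes deriv: "\<And>k t. (g k has_vector_derivative g (Suc k) t) (at t)"
    and U: "open U" and K: "compact K" "K \<subseteq> U" and van: "\<And>k t. t \<notin> K \<Longrightarrow> g k t = 0"
    and "m \<ge> 1"
  shows "ennreal (hardy_const m) * (\<integral>\<^sup>+t. ennreal ((cmod (g 0 t))\<^sup>2) * inverse (dist_dir U 1 t ^ (2 * m)) \<partial>lborel)
    \<le> (\<integral>\<^sup>+t. ennreal ((cmod (g m t))\<^sup>2) \<partial>lborel)"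
proof (cases "U = UNIV")
  \<comment> \<open>With an empty complement the distance is top and the weight is 0, because the
    exponent 2m is positive.\<close>
  case True
  then have "dist_dir U 1 t = top" for t by (simp add: dist_dir_def)
  then show ?thesis using \<open>m \<ge> 1\<close> by (simp add: power_eq_top_ennreal)
next
  case False
  have cont: "continuous_on UNIV (g k)" for k
    using deriv[of k] by (auto intro!: continuous_at_imp_continuous_on has_vector_derivative_continuous)
  have [measurable]: "g k \<in> borel_measurable borel" for k
    using cont by (rule borel_measurable_continuous_onI)
  have [measurable]: "(\<lambda>t. infdist t C) \<in> borel_measurable borel" for C :: "real set"
    by (intro borel_measurable_continuous_onI continuous_intros)
  obtain D where D: "countable D" "D \<subseteq> - U" "- U \<subseteq> closure D" by (rule separable)
  then have "D \<noteq> {}" using False by auto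
  define F where "F n = from_nat_into D ` {..n}" for n
  have FD: "F n \<subseteq> D" for n unfolding F_def by (meson \<open>D \<noteq> {}\<close> from_nat_into image_subsetI)
  have UF: "(\<Union>n. F n) = D"
  proof -
    have "(\<Union>n. F n) = range (from_nat_into D)" by (auto simp: F_def)
    then show ?thesis using \<open>D \<noteq> {}\<close> D(1) by (simp add: range_from_nat_into)
  qed
  have lim: "(\<lambda>n. infdist t (F n)) \<longlonglongrightarrow> infdist t (- U)" for t
    by (rule infdist_increasing_tendsto) (use FD UF D in \<open>auto simp: F_def incseq_def\<close>)
  have fin: "ennreal (hardy_const m) * (\<integral>\<^sup>+t. ennreal ((cmod (g 0 t))\<^sup>2 / (infdist t (F n)) ^ (2 * m)) \<partial>lborel)
    \<le> (\<integral>\<^sup>+t. ennreal ((cmod (g m t))\<^sup>2) \<partial>lborel)" for n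
  proof (rule hardy_finite[of g "F n" m])
    show "\<exists>\<delta>>0. \<forall>k t. \<bar>t - a\<bar> < \<delta> \<longrightarrow> g k t = 0" if "a \<in> F n" for a
    proof -
      have "a \<in> - K" using that FD D K by blast
      moreover have "open (- K)" using K compact_imp_closed by blast
      ultimately obtain \<delta> where "\<delta> > 0" "ball a \<delta> \<subseteq> - K" by (meson open_contains_ball)
      moreover have "t \<in> ball a \<delta>" if "\<bar>t - a\<bar> < \<delta>" for t
        using that by (simp add: dist_real_def abs_minus_commute)
      ultimately show ?thesis using van by (metis ComplD subsetD)
    qed
    show "bounded {t. g 0 t \<noteq> 0}"
      using K van by (meson bounded_subset compact_imp_bounded mem_Collect_eq subsetI)
  qed (auto simp: F_def deriv)
  \<comment> \<open>On \<open>K\<close> the limiting distance is positive, so the quotients converge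
    as real numbers; off \<open>K\<close> the function \<open>g 0\<close> is zero.\<close>
  have pw: "ennreal (hardy_const m) * (ennreal ((cmod (g 0 t))\<^sup>2) * inverse (dist_dir U 1 t ^ (2 * m)))
      \<le> liminf (\<lambda>n. ennreal (hardy_const m) * ennreal ((cmod (g 0 t))\<^sup>2 / (infdist t (F n)) ^ (2 * m)))" for t
  proof (cases "t \<in> K")
    case True
    then have "t \<notin> - U" using K by auto
    then have pos: "0 < infdist t (- U)"
      using infdist_pos_not_in_closed[of "- U" t] U \<open>U \<noteq> UNIV\<close> by auto
    then have "(\<lambda>n. ennreal (hardy_const m * ((cmod (g 0 t))\<^sup>2 / (infdist t (F n)) ^ (2 * m))))
        \<longlonglongrightarrow> ennreal (hardy_const m * ((cmod (g 0 t))\<^sup>2 / (infdist t (- U)) ^ (2 * m)))"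
      by (intro tendsto_ennrealI tendsto_intros lim) auto
    then have "liminf (\<lambda>n. ennreal (hardy_const m * ((cmod (g 0 t))\<^sup>2 / (infdist t (F n)) ^ (2 * m))))
        = ennreal (hardy_const m * ((cmod (g 0 t))\<^sup>2 / (infdist t (- U)) ^ (2 * m)))"
      by (intro lim_imp_Liminf) auto
    moreover have "inverse (dist_dir U 1 t ^ (2 * m)) = ennreal (1 / (infdist t (- U)) ^ (2 * m))"
      using pos by (simp add: dist_dir_real[OF \<open>U \<noteq> UNIV\<close>] ennreal_power inverse_ennreal inverse_eq_divide)
    ultimately show ?thesis
      by (simp add: ennreal_mult'[symmetric] hardy_const_nonneg infdist_nonneg)
  qed (simp add: van)
  have dm[measurable]: "(\<lambda>t. dist_dir U 1 t) \<in> borel_measurable borel"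
    unfolding dist_dir_real[OF False]
    by (intro measurable_compose[OF _ measurable_ennreal] borel_measurable_continuous_onI continuous_intros)
  have "ennreal (hardy_const m) * (\<integral>\<^sup>+t. ennreal ((cmod (g 0 t))\<^sup>2) * inverse (dist_dir U 1 t ^ (2 * m)) \<partial>lborel)
     = (\<integral>\<^sup>+t. ennreal (hardy_const m) * (ennreal ((cmod (g 0 t))\<^sup>2) * inverse (dist_dir U 1 t ^ (2 * m))) \<partial>lborel)"
    by (intro nn_integral_cmult[symmetric]) measurable
  also have "\<dots> \<le> (\<integral>\<^sup>+t. liminf (\<lambda>n. ennreal (hardy_const m) * ennreal ((cmod (g 0 t))\<^sup>2 / (infdist t (F n)) ^ (2 * m))) \<partial>lborel)"
    by (intro nn_integral_mono pw)
  also have "\<dots> \<le> liminf (\<lambda>n. \<integral>\<^sup>+t. ennreal (hardy_const m) * ennreal ((cmod (g 0 t))\<^sup>2 / (infdist t (F n)) ^ (2 * m)) \<partial>lborel)"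
    by (intro nn_integral_liminf) measurable
  also have "\<dots> \<le> liminf (\<lambda>n. \<integral>\<^sup>+t. ennreal ((cmod (g m t))\<^sup>2) \<partial>lborel)"
    using fin by (intro Liminf_mono always_eventually allI) (subst nn_integral_cmult; simp)
  also have "\<dots> = (\<integral>\<^sup>+t. ennreal ((cmod (g m t))\<^sup>2) \<partial>lborel)"
    by (simp add: Liminf_const)
  finally show ?thesis .
qed

section \<open>Integration by parts\<close>

lemma nn_integral_lborel_translate:
  fixes f :: "'a::euclidean_space \<Rightarrow> ennreal"
  assumes "f \<in> borel_measurable borel"
  shows "(\<integral>\<^sup>+x. f (c + x) \<partial>lborel) = (\<integral>\<^sup>+x. f x \<partial>lborel)"
  by (subst lborel_distr_plus[symmetric, of c], subst nn_integral_distr) (use assms in auto)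

lemma integral_lborel_translate:
  fixes f :: "'a::euclidean_space \<Rightarrow> 'b::euclidean_space"
  assumes "integrable lborel f"
  shows "integrable lborel (\<lambda>x. f (c + x))" "(\<integral>x. f (c + x) \<partial>lborel) = (\<integral>x. f x \<partial>lborel)"
proof -
  have f: "f \<in> borel_measurable borel" using assms by auto
  have "integrable (distr lborel borel ((+) c)) f" using assms by (simp add: lborel_distr_plus)
  then show "integrable lborel (\<lambda>x. f (c + x))"
    using f by (subst (asm) integrable_distr_eq) auto
  show "(\<integral>x. f (c + x) \<partial>lborel) = (\<integral>x. f x \<partial>lborel)"
    by (subst (2) lborel_distr_plus[symmetric, of c], subst integral_distr) (use f in auto)
qed

text \<open>Integrate H(x + t y) over t in [0,1] and all x. By Fubini and translation invariance the
  result is the integral of H; by the fundamental theorem it is the integral of h(x + y) - h(x),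
  which is 0. Resting on integrability rather than compact support, it serves both the x-integrals
  and the Gaussian y-integrals.\<close>

lemma integral_directional_derivative_eq_0:
  fixes h H :: "'a::euclidean_space \<Rightarrow> 'b::euclidean_space"
  assumes h: "integrable lborel h" and H: "integrable lborel H" and cont: "continuous_on UNIV H"
    and deriv: "\<And>x t. ((\<lambda>t. h (x + t *\<^sub>R y)) has_vector_derivative H (x + t *\<^sub>R y)) (at t)"
  shows "(\<integral>x. H x \<partial>lborel) = 0"
proof -
  have [measurable]: "H \<in> borel_measurable borel" using H by auto
  define k where "k t x = indicat_real {0..1} t *\<^sub>R H (t *\<^sub>R y + x)" for t x
  have k[measurable]: "case_prod k \<in> borel_measurable (lborel \<Otimes>\<^sub>M lborel)"
    unfolding k_def case_prod_beta by measurable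
  have inner: "(\<integral>x. norm (k t x) \<partial>lborel) = indicat_real {0..1} t * (\<integral>x. norm (H x) \<partial>lborel)" for t
  proof -
    have "integrable lborel (\<lambda>x. norm (H x))" using H by simp
    from integral_lborel_translate(2)[OF this, of "t *\<^sub>R y"] show ?thesis
      by (simp add: k_def)
  qed
  have int: "integrable (lborel \<Otimes>\<^sub>M lborel) (case_prod k)"
  proof (rule lborel_pair.Fubini_integrable[OF k])
    have "integrable lborel (\<lambda>t::real. indicat_real {0..1} t * (\<integral>x. norm (H x) \<partial>lborel))"
      by (intro integrable_mult_left integrable_real_indicator) auto
    then show "integrable lborel (\<lambda>t. \<integral>x. norm (case (t, x) of (t, x) \<Rightarrow> k t x) \<partial>lborel)"
      by (simp add: inner)
    have "integrable lborel (k t)" for t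
      unfolding k_def by (intro integrable_scaleR_right impI integral_lborel_translate(1)[OF H])
    then show "AE t in lborel. integrable lborel (\<lambda>x. case (t, x) of (t, x) \<Rightarrow> k t x)" by simp
  qed
  have "(\<integral>x. (\<integral>t. k t x \<partial>lborel) \<partial>lborel) = (\<integral>t. (\<integral>x. k t x \<partial>lborel) \<partial>lborel)"
    by (rule lborel_pair.Fubini_integral[OF int])
  also have "\<dots> = (\<integral>t. indicat_real {0..1::real} t *\<^sub>R (\<integral>x. H x \<partial>lborel) \<partial>lborel)"
    unfolding k_def using integral_lborel_translate(2)[OF H] by simp
  also have "\<dots> = (\<integral>x. H x \<partial>lborel)"
    by (subst integral_scaleR_left) (auto intro: integrable_real_indicator)
  finally have 1: "(\<integral>x. H x \<partial>lborel) = (\<integral>x. (\<integral>t. k t x \<partial>lborel) \<partial>lborel)" by simp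
  have 2: "(\<integral>t. k t x \<partial>lborel) = h (y + x) - h x" for x
  proof -
    have "integral\<^sup>L lborel (\<lambda>t. indicator {0..1} t *\<^sub>R H (x + t *\<^sub>R y)) = h (x + 1 *\<^sub>R y) - h (x + 0 *\<^sub>R y)"
      by (rule integral_FTC_atLeastAtMost)
        (auto intro!: has_vector_derivative_at_within deriv continuous_on_compose2[OF cont] continuous_intros)
    then show ?thesis by (simp add: k_def add.commute)
  qed
  have "(\<integral>x. h (y + x) - h x \<partial>lborel) = 0"
    using integral_lborel_translate[OF h, of y] h by (subst Bochner_Integration.integral_diff) auto
  then show ?thesis by (simp only: 1 2)
qed

lemma integrable_continuous_compact_support:
  fixes h :: "'a::euclidean_space \<Rightarrow> 'b::euclidean_space"
  assumes "continuous_on UNIV h" "compact K" "\<And>x. x \<notin> K \<Longrightarrow> h x = 0"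
  shows "integrable lborel h"
proof -
  have "integrable lborel (\<lambda>x. indicator K x *\<^sub>R h x)"
    using assms by (intro borel_integrable_compact continuous_on_subset[OF assms(1)]) auto
  also have "(\<lambda>x. indicator K x *\<^sub>R h x) = h"
    using assms(3) by (auto simp: indicator_def fun_eq_iff)
  finally show ?thesis .
qed

section \<open>Gaussian moments\<close>

definition gauss :: "'a::euclidean_space \<Rightarrow> real" where
  "gauss y = exp (- (y \<bullet> y) / 2)"

lemma gauss_pos: "0 < gauss y" by (simp add: gauss_def)

lemma continuous_on_gauss [continuous_intros]: "continuous_on A gauss"
  unfolding gauss_def by (intro continuous_intros) auto

lemma borel_measurable_gauss [measurable]: "gauss \<in> borel_measurable borel"
  by (intro borel_measurable_continuous_onI continuous_intros)

lemma inner_self_has_real_derivative: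
  "((\<lambda>t. (x + t *\<^sub>R y) \<bullet> (x + t *\<^sub>R y)) has_real_derivative 2 * (y \<bullet> (x + t *\<^sub>R y))) (at t)"
proof -
  have "((\<lambda>t. (x \<bullet> x + 2 * t * (y \<bullet> x) + t\<^sup>2 * (y \<bullet> y))) has_real_derivative 2 * (y \<bullet> (x + t *\<^sub>R y))) (at t)"
    by (rule derivative_eq_intros refl)+ (simp add: inner_simps)
  moreover have "(x + t *\<^sub>R y) \<bullet> (x + t *\<^sub>R y) = x \<bullet> x + 2 * t * (y \<bullet> x) + t\<^sup>2 * (y \<bullet> y)" for t
    by (simp add: inner_simps inner_commute power2_eq_square algebra_simps)
  ultimately show ?thesis by simp
qed

lemma gauss_has_real_derivative:
  "((\<lambda>t. gauss (x + t *\<^sub>R y)) has_real_derivative - (y \<bullet> (x + t *\<^sub>R y)) * gauss (x + t *\<^sub>R y)) (at t)"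
proof -
  have "((\<lambda>t. exp (- ((x + t *\<^sub>R y) \<bullet> (x + t *\<^sub>R y)) / 2)) has_real_derivative
     exp (- ((x + t *\<^sub>R y) \<bullet> (x + t *\<^sub>R y)) / 2) * (- (2 * (y \<bullet> (x + t *\<^sub>R y))) / 2)) (at t)"
    by (intro DERIV_fun_exp DERIV_cdivide DERIV_minus inner_self_has_real_derivative)
  then show ?thesis by (simp add: gauss_def mult.commute)
qed

lemma power_le_fact_exp:
  fixes x :: real
  assumes "0 \<le> x" shows "x ^ k \<le> fact k * exp x"
proof -
  have "x ^ k /\<^sub>R fact k \<le> (\<Sum>n. x ^ n /\<^sub>R fact n)"
    using assms sum_le_suminf[of "\<lambda>n. x ^ n /\<^sub>R fact n" "{k}"] exp_converges[of x]
    by (auto simp: sums_iff)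
  also have "\<dots> = exp x" using exp_converges[of x] by (simp add: sums_iff)
  finally show ?thesis by (simp add: field_simps)
qed

text \<open>This is the dominating function left after half of the Gaussian exponent has absorbed a
  polynomial. It factors over the coordinates into multiples of the normal density of variance
  2.\<close>

lemma integrable_exp_quarter: "integrable lborel (\<lambda>y::'a::euclidean_space. exp (- (y \<bullet> y) / 4))"
proof (rule integrableI_nonneg)
  have fin: "(\<integral>\<^sup>+t. ennreal (exp (- (t * t) / 4)) \<partial>lborel) < \<infinity>"
  proof -
    have "integrable lborel (\<lambda>t. sqrt (4 * pi) * normal_density 0 (sqrt 2) t)"
      by (intro integrable_mult_right) auto
    also have "(\<lambda>t. sqrt (4 * pi) * normal_density 0 (sqrt 2) t) = (\<lambda>t. exp (- (t * t) / 4))"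
      by (simp add: fun_eq_iff normal_density_def power2_eq_square)
    finally show ?thesis
      by (subst nn_integral_eq_integral) auto
  qed
  have "(\<integral>\<^sup>+y. ennreal (exp (- (y \<bullet> y) / 4)) \<partial>(lborel :: 'a measure))
     = (\<integral>\<^sup>+y. (\<Prod>b\<in>Basis. ennreal (exp (- ((y \<bullet> b) * (y \<bullet> b)) / 4))) \<partial>(lborel :: 'a measure))"
    by (intro nn_integral_cong)
      (simp add: euclidean_inner[of y y for y :: 'a] prod_ennreal exp_sum[symmetric] sum_divide_distrib sum_negf)
  also have "\<dots> = (\<Prod>b\<in>(Basis::'a set). (\<integral>\<^sup>+t. ennreal (exp (- (t * t) / 4)) \<partial>lborel))"
    by (subst nn_integral_lborel_prod) auto
  also have "\<dots> < \<infinity>"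
    using fin by (simp add: ennreal_prod_eq_top power_less_top_ennreal)
  finally show "(\<integral>\<^sup>+y. ennreal (exp (- (y \<bullet> y) / 4)) \<partial>(lborel::'a measure)) < \<infinity>" .
qed auto

text \<open>With q = y . y one has |y|^k \<le> 1 + q^k, where the 1 handles |y| \<le> 1, and q^k
  \<le> 4^k k! exp(q/4). Multiplying by exp(-q/2) leaves exp(-q/4).\<close>

lemma integrable_norm_power_gauss: "integrable lborel (\<lambda>y::'a::euclidean_space. norm y ^ k * gauss y)"
proof (rule Bochner_Integration.integrable_bound)
  show "integrable lborel (\<lambda>y::'a. (1 + 4 ^ k * fact k) * exp (- (y \<bullet> y) / 4))"
    by (intro integrable_mult_right integrable_exp_quarter) 
  show "AE y in lborel. norm (norm y ^ k * gauss (y::'a)) \<le> norm ((1 + 4 ^ k * fact k) * exp (- (y \<bullet> y) / 4))"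
  proof (intro AE_I2)
    fix y :: 'a
    have q: "y \<bullet> y = (norm y)\<^sup>2" by (simp add: power2_norm_eq_inner)
    have "norm y ^ k \<le> 1 + (norm y)\<^sup>2 ^ k"
    proof (cases "norm y \<le> 1")
      case True
      then have "norm y ^ k \<le> 1" by (simp add: power_le_one)
      then show ?thesis by (smt (verit) zero_le_power zero_le_power2)
    next
      case False
      then have "norm y ^ k \<le> ((norm y)\<^sup>2) ^ k" using self_le_power[of "norm y" 2] by (intro power_mono) auto
      then show ?thesis by simp
    qed
    also have "(norm y)\<^sup>2 ^ k = 4 ^ k * ((y \<bullet> y) / 4) ^ k"
      by (simp add: q power_divide)
    also have "\<dots> \<le> 4 ^ k * (fact k * exp ((y \<bullet> y) / 4))"
      by (intro mult_left_mono power_le_fact_exp) auto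
    finally have "norm y ^ k \<le> 1 + 4 ^ k * fact k * exp ((y \<bullet> y) / 4)" by simp
    also have "\<dots> \<le> (1 + 4 ^ k * fact k) * exp ((y \<bullet> y) / 4)"
      by (simp add: algebra_simps)
    finally have "norm y ^ k * gauss y \<le> (1 + 4 ^ k * fact k) * exp ((y \<bullet> y) / 4) * gauss y"
      using gauss_pos[of y] by (intro mult_right_mono) auto
    also have "\<dots> = (1 + 4 ^ k * fact k) * exp (- (y \<bullet> y) / 4)"
      by (simp add: gauss_def exp_add[symmetric] mult.assoc)
    finally show "norm (norm y ^ k * gauss y) \<le> norm ((1 + 4 ^ k * fact k) * exp (- (y \<bullet> y) / 4))"
      using gauss_pos[of y] by (simp add: abs_mult)
  qed
qed measurable

lemma integrable_poly_gauss:
  fixes P :: "'a::euclidean_space \<Rightarrow> 'b::euclidean_space"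
  assumes "continuous_on UNIV P" "\<And>y. norm (P y) \<le> C * norm y ^ k"
  shows "integrable lborel (\<lambda>y. gauss y *\<^sub>R P y)"
proof (rule Bochner_Integration.integrable_bound)
  show "integrable lborel (\<lambda>y::'a. C * (norm y ^ k * gauss y))"
    by (intro integrable_mult_right integrable_norm_power_gauss)
  have [measurable]: "P \<in> borel_measurable borel" using assms(1) by (rule borel_measurable_continuous_onI)
  show "(\<lambda>y. gauss y *\<^sub>R P y) \<in> borel_measurable lborel" by measurable
  show "AE y in lborel. norm (gauss y *\<^sub>R P y) \<le> norm (C * (norm y ^ k * gauss y))"
  proof (intro AE_I2)
    fix y
    have "norm (gauss y *\<^sub>R P y) \<le> gauss y * (C * norm y ^ k)"
      using assms(2)[of y] gauss_pos[of y] by (simp add: mult_left_mono)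
    also have "\<dots> = C * (norm y ^ k * gauss y)" by simp
    finally show "norm (gauss y *\<^sub>R P y) \<le> norm (C * (norm y ^ k * gauss y))" by simp
  qed
qed

text \<open>The derivative of \<open>gauss\<close> in direction \<open>b\<close> is -(y . b)
  \<open>gauss\<close>, so a factor y . b can be exchanged for a derivative of the remaining factor.
  The bounds on \<open>P\<close> and \<open>P'\<close> supply the integrability, and no boundary
  term arises.\<close>

lemma gauss_by_parts:
  fixes P P' :: "'a::euclidean_space \<Rightarrow> 'b::euclidean_space"
  assumes c: "b \<in> Basis" and P: "continuous_on UNIV P" "\<And>y. norm (P y) \<le> C * norm y ^ k"
    and P': "continuous_on UNIV P'" "\<And>y. norm (P' y) \<le> C' * norm y ^ k'"
    and deriv: "\<And>y t. ((\<lambda>t. P (y + t *\<^sub>R b)) has_vector_derivative P' (y + t *\<^sub>R b)) (at t)"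
  shows "integrable lborel (\<lambda>y. gauss y *\<^sub>R (y \<bullet> b) *\<^sub>R P y)"
    and "(\<integral>y. gauss y *\<^sub>R (y \<bullet> b) *\<^sub>R P y \<partial>lborel) = (\<integral>y. gauss y *\<^sub>R P' y \<partial>lborel)"
proof -
  have n: "norm ((y \<bullet> b) *\<^sub>R P y) \<le> C * norm y ^ Suc k" for y
  proof -
    have "norm ((y \<bullet> b) *\<^sub>R P y) \<le> norm y * (C * norm y ^ k)"
      using P(2)[of y] Basis_le_norm[OF c, of y] by (simp add: mult_mono)
    then show ?thesis by (simp add: algebra_simps)
  qed
  have i1: "integrable lborel (\<lambda>y. gauss y *\<^sub>R P y)" by (rule integrable_poly_gauss[OF P])
  have i2: "integrable lborel (\<lambda>y. gauss y *\<^sub>R P' y)" by (rule integrable_poly_gauss[OF P'])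
  show i3: "integrable lborel (\<lambda>y. gauss y *\<^sub>R (y \<bullet> b) *\<^sub>R P y)"
    by (rule integrable_poly_gauss[OF _ n]) (intro continuous_intros P)
  have "(\<integral>y. gauss y *\<^sub>R P' y - gauss y *\<^sub>R (y \<bullet> b) *\<^sub>R P y \<partial>lborel) = 0"
  proof (rule integral_directional_derivative_eq_0[where h = "\<lambda>y. gauss y *\<^sub>R P y" and y = b])
    show "continuous_on UNIV (\<lambda>y. gauss y *\<^sub>R P' y - gauss y *\<^sub>R (y \<bullet> b) *\<^sub>R P y)"
      by (intro continuous_intros P P')
    show "((\<lambda>t. gauss (x + t *\<^sub>R b) *\<^sub>R P (x + t *\<^sub>R b)) has_vector_derivative
        gauss (x + t *\<^sub>R b) *\<^sub>R P' (x + t *\<^sub>R b) - gauss (x + t *\<^sub>R b) *\<^sub>R ((x + t *\<^sub>R b) \<bullet> b) *\<^sub>R P (x + t *\<^sub>R b)) (at t)" for x t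
      using has_vector_derivative_scaleR[OF gauss_has_real_derivative[of x b t] deriv[of x t]]
      by (simp add: inner_commute mult.commute)
  qed (intro i1 Bochner_Integration.integrable_diff i2 i3)+
  then show "(\<integral>y. gauss y *\<^sub>R (y \<bullet> b) *\<^sub>R P y \<partial>lborel) = (\<integral>y. gauss y *\<^sub>R P' y \<partial>lborel)"
    unfolding Bochner_Integration.integral_diff[OF i2 i3] by (simp only: right_minus_eq)
qed

text \<open>The value is (2 pi)^(N/2), but it enters the averages of both sides of the inequality
  and cancels; only its positivity matters.\<close>

definition gauss_mass :: "'a::euclidean_space itself \<Rightarrow> real" where
  "gauss_mass _ = (\<integral>y. gauss y \<partial>(lborel :: 'a measure))"

lemma integrable_gauss: "integrable lborel (gauss :: 'a::euclidean_space \<Rightarrow> real)"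
  using integrable_norm_power_gauss[of 0] by simp

lemma gauss_mass_pos: "0 < gauss_mass TYPE('a::euclidean_space)"
proof -
  have "(\<integral>y. gauss y \<partial>(lborel :: 'a measure)) \<noteq> 0"
  proof
    assume "(\<integral>y. gauss y \<partial>(lborel :: 'a measure)) = 0"
    then have "AE y in (lborel :: 'a measure). gauss y = 0"
      by (subst (asm) integral_nonneg_eq_0_iff_AE[OF integrable_gauss]) (auto simp: gauss_pos less_imp_le)
    then have "AE y in (lborel :: 'a measure). False"
      by eventually_elim (use gauss_pos in \<open>metis less_irrefl\<close>)
    then have "emeasure (lborel :: 'a measure) UNIV = 0"
      by (subst (asm) AE_iff_measurable[where N = UNIV]) auto
    then show False by simp
  qed
  moreover have "0 \<le> (\<integral>y. gauss y \<partial>(lborel :: 'a measure))"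
    by (intro Bochner_Integration.integral_nonneg) (simp add: gauss_pos less_imp_le)
  ultimately show ?thesis by (simp add: gauss_mass_def)
qed

lemma inner_power_has_real_derivative:
  "((\<lambda>t. ((x + t *\<^sub>R y) \<bullet> (x + t *\<^sub>R y)) ^ m) has_real_derivative
     2 * real m * (y \<bullet> (x + t *\<^sub>R y)) * ((x + t *\<^sub>R y) \<bullet> (x + t *\<^sub>R y)) ^ (m - 1)) (at t)"
  using DERIV_power[OF inner_self_has_real_derivative[of x y t], of m] by (simp add: algebra_simps)

text \<open>Split one factor y . y into the squares (y . b)^2 and integrate by parts in each
  direction b. The divergence of |y|^(2m) y is (N + 2m) |y|^(2m), which gives the new factor of the
  product.\<close>

lemma gauss_moment:
  "(\<integral>y. gauss y * (y \<bullet> y) ^ m \<partial>(lborel :: 'a::euclidean_space measure))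
    = (\<Prod>k<m. real (DIM('a) + 2 * k)) * gauss_mass TYPE('a)"
proof (induction m)
  case (Suc m)
  have int: "integrable lborel (\<lambda>y::'a. gauss y * (y \<bullet> y) ^ m)"
  proof -
    have "norm y ^ (2 * m) = (y \<bullet> y) ^ m" for y :: 'a
      by (simp only: power_mult power2_norm_eq_inner)
    then show ?thesis
      using integrable_norm_power_gauss[of "2 * m", where 'a='a] by (simp add: mult.commute)
  qed
  have nP: "norm ((y \<bullet> b) * (y \<bullet> y) ^ m) \<le> 1 * norm y ^ (2 * m + 1)" if "b \<in> Basis" for y b :: 'a
    using Basis_le_norm[OF that, of y]
    by (simp add: abs_mult power_mult power2_norm_eq_inner[symmetric] mult_right_mono)
  \<comment> \<open>For m = 0 the exponent m - 1 is truncated to 0, but the factor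
    \<open>real m\<close> removes that term.\<close>
  define P' where "P' b y = (y \<bullet> y) ^ m + 2 * real m * (y \<bullet> b)\<^sup>2 * (y \<bullet> y) ^ (m - 1)" for b y :: 'a
  have nP': "norm (P' b y) \<le> (1 + 2 * real m) * norm y ^ (2 * m)" if "b \<in> Basis" for y b
  proof (cases m)
    case (Suc n)
    have "(y \<bullet> b)\<^sup>2 \<le> y \<bullet> y"
      using Basis_le_norm[OF that, of y] abs_le_square_iff[of "y \<bullet> b" "norm y"]
      by (simp add: power2_norm_eq_inner)
    then have "2 * real m * (y \<bullet> b)\<^sup>2 * (y \<bullet> y) ^ (m - 1) \<le> 2 * real m * (y \<bullet> y) * (y \<bullet> y) ^ (m - 1)"
      by (intro mult_right_mono mult_left_mono) auto
    also have "\<dots> = 2 * real m * (y \<bullet> y) ^ m" using Suc by simp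
    finally have "P' b y \<le> (1 + 2 * real m) * (y \<bullet> y) ^ m" by (simp add: P'_def algebra_simps)
    moreover have "0 \<le> P' b y" by (auto simp: P'_def intro!: add_nonneg_nonneg mult_nonneg_nonneg)
    ultimately show ?thesis by (simp add: power_mult power2_norm_eq_inner)
  qed (simp add: P'_def)
  have part: "integrable lborel (\<lambda>y. gauss y *\<^sub>R (y \<bullet> b) *\<^sub>R ((y \<bullet> b) * (y \<bullet> y) ^ m))"
    "(\<integral>y. gauss y *\<^sub>R (y \<bullet> b) *\<^sub>R ((y \<bullet> b) * (y \<bullet> y) ^ m) \<partial>lborel) = (\<integral>y. gauss y *\<^sub>R P' b y \<partial>lborel)"
    if b: "b \<in> Basis" for b :: 'a
  proof -
    have d: "((\<lambda>t. ((y + t *\<^sub>R b) \<bullet> b) * ((y + t *\<^sub>R b) \<bullet> (y + t *\<^sub>R b)) ^ m) has_vector_derivative P' b (y + t *\<^sub>R b)) (at t)"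
      for y t
    proof -
      have "((\<lambda>t. (y + t *\<^sub>R b) \<bullet> b) has_real_derivative 1) (at t)"
        unfolding inner_simps inner_Basis[OF b b] by (auto intro!: derivative_eq_intros)
      from DERIV_mult[OF this inner_power_has_real_derivative[of y b m t]] show ?thesis
        unfolding has_real_derivative_iff_has_vector_derivative[symmetric] P'_def
        by (simp add: power2_eq_square inner_commute algebra_simps)
    qed
    have c: "continuous_on UNIV (\<lambda>y. (y \<bullet> b) * (y \<bullet> y) ^ m)" "continuous_on UNIV (P' b)"
      unfolding P'_def by (intro continuous_intros)+
    show "integrable lborel (\<lambda>y. gauss y *\<^sub>R (y \<bullet> b) *\<^sub>R ((y \<bullet> b) * (y \<bullet> y) ^ m))"
      by (rule gauss_by_parts(1)[OF b c(1) nP[OF b] c(2) nP'[OF b] d])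
    show "(\<integral>y. gauss y *\<^sub>R (y \<bullet> b) *\<^sub>R ((y \<bullet> b) * (y \<bullet> y) ^ m) \<partial>lborel) = (\<integral>y. gauss y *\<^sub>R P' b y \<partial>lborel)"
      by (rule gauss_by_parts(2)[OF b c(1) nP[OF b] c(2) nP'[OF b] d])
  qed
  have iP': "integrable lborel (\<lambda>y. gauss y *\<^sub>R P' b y)" if "b \<in> Basis" for b
    by (rule integrable_poly_gauss[OF _ nP'[OF that]]) (auto simp: P'_def intro!: continuous_intros)
  have sq: "(\<Sum>b\<in>Basis. (y \<bullet> b) * (y \<bullet> b)) = y \<bullet> y" for y :: 'a
    by (simp add: euclidean_inner[of y y])
  have "(\<integral>y. gauss y * (y \<bullet> y) ^ Suc m \<partial>(lborel :: 'a measure))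
      = (\<integral>y. (\<Sum>b\<in>Basis. gauss y *\<^sub>R (y \<bullet> b) *\<^sub>R ((y \<bullet> b) * (y \<bullet> y) ^ m)) \<partial>(lborel :: 'a measure))"
  proof (intro Bochner_Integration.integral_cong refl)
    fix y :: 'a
    have "(\<Sum>b\<in>Basis. gauss y *\<^sub>R (y \<bullet> b) *\<^sub>R ((y \<bullet> b) * (y \<bullet> y) ^ m))
      = (\<Sum>b\<in>Basis. (y \<bullet> b) * (y \<bullet> b)) * (gauss y * (y \<bullet> y) ^ m)"
      unfolding sum_distrib_right by (intro sum.cong) (auto simp: mult_ac)
    then show "gauss y * (y \<bullet> y) ^ Suc m = (\<Sum>b\<in>Basis. gauss y *\<^sub>R (y \<bullet> b) *\<^sub>R ((y \<bullet> b) * (y \<bullet> y) ^ m))"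
      by (simp add: sq mult_ac)
  qed
  also have "\<dots> = (\<Sum>b\<in>Basis. \<integral>y. gauss y *\<^sub>R P' b y \<partial>(lborel :: 'a measure))"
    by (subst Bochner_Integration.integral_sum) (use part in auto)
  also have "\<dots> = (\<integral>y. (\<Sum>b\<in>Basis. gauss y *\<^sub>R P' b y) \<partial>(lborel :: 'a measure))"
    by (subst Bochner_Integration.integral_sum) (use iP' in auto)
  also have "\<dots> = (\<integral>y. real (DIM('a) + 2 * m) * (gauss y * (y \<bullet> y) ^ m) \<partial>(lborel :: 'a measure))"
  proof (intro Bochner_Integration.integral_cong refl)
    fix y :: 'a
    have "(\<Sum>b\<in>Basis. P' b y) = real DIM('a) * (y \<bullet> y) ^ m + 2 * real m * (\<Sum>b\<in>Basis. (y \<bullet> b) * (y \<bullet> b)) * (y \<bullet> y) ^ (m - 1)"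
      by (simp add: P'_def sum.distrib sum_distrib_left sum_distrib_right power2_eq_square mult_ac)
    also have "\<dots> = real (DIM('a) + 2 * m) * (y \<bullet> y) ^ m"
      by (cases m) (simp_all add: sq algebra_simps)
    finally show "(\<Sum>b\<in>Basis. gauss y *\<^sub>R P' b y) = real (DIM('a) + 2 * m) * (gauss y * (y \<bullet> y) ^ m)"
      by (simp add: sum_distrib_left[symmetric] mult_ac)
  qed
  also have "\<dots> = real (DIM('a) + 2 * m) * (\<integral>y. gauss y * (y \<bullet> y) ^ m \<partial>(lborel :: 'a measure))"
    by (rule integral_mult_right_zero)
  finally show ?case using Suc by (simp add: mult_ac)
qed (simp add: gauss_mass_def)

section \<open>The Gaussian average of the directional energies\<close>

lemma pd_linear_sum:
  assumes "\<And>i. i \<in> I \<Longrightarrow> smooth_fun (F i)" "finite I"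
  shows "pd b (\<lambda>x. \<Sum>i\<in>I. F i x) = (\<lambda>x. \<Sum>i\<in>I. pd b (F i) x)"
  using assms(2,1)
proof (induction I)
  case empty
  then show ?case by (simp add: pd_def fun_eq_iff)
next
  case (insert i I)
  then have "pd b (\<lambda>x. (\<Sum>i\<in>I. F i x) + 1 * F i x) x = pd b (\<lambda>x. \<Sum>i\<in>I. F i x) x + 1 * pd b (F i) x" for x
    by (intro pd_lin smooth_fun_differentiable smooth_fun_sum) auto
  with insert show ?case by (simp add: add.commute fun_eq_iff)
qed

lemma dder_sum:
  assumes "\<And>i. i \<in> I \<Longrightarrow> smooth_fun (F i)" "finite I"
  shows "dder y k (\<lambda>x. \<Sum>i\<in>I. F i x) x = (\<Sum>i\<in>I. dder y k (F i) x)"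
  using assms
proof (induction k arbitrary: F x)
  case (Suc k)
  have "dder y (Suc k) (\<lambda>x. \<Sum>i\<in>I. F i x) x
    = (\<Sum>b\<in>Basis. of_real (y \<bullet> b) * (\<Sum>i\<in>I. dder y k (pd b (F i)) x))"
  proof -
    have "dder y k (pd b (\<lambda>x. \<Sum>i\<in>I. F i x)) x = (\<Sum>i\<in>I. dder y k (pd b (F i)) x)" if "b \<in> Basis" for b
    proof -
      have "pd b (\<lambda>x. \<Sum>i\<in>I. F i x) = (\<lambda>x. \<Sum>i\<in>I. pd b (F i) x)"
        by (rule pd_linear_sum) (use Suc.prems in auto)
      moreover have "dder y k (\<lambda>x. \<Sum>i\<in>I. pd b (F i) x) x = (\<Sum>i\<in>I. dder y k (pd b (F i)) x)"
        by (rule Suc.IH) (use Suc.prems that in \<open>auto intro: smooth_fun_pd\<close>)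
      ultimately show ?thesis by simp
    qed
    then show ?thesis by simp
  qed
  also have "\<dots> = (\<Sum>i\<in>I. dder y (Suc k) (F i) x)"
    by (simp add: sum_distrib_left) (rule sum.swap)
  finally show ?case .
qed simp

lemma dder_lin:
  assumes "smooth_fun f" "smooth_fun g"
  shows "dder y k (\<lambda>x. f x + c * g x) x = dder y k f x + c * dder y k g x"
  using assms
proof (induction k arbitrary: f g x)
  case (Suc k)
  have "dder y k (pd b (\<lambda>x. f x + c * g x)) x = dder y k (pd b f) x + c * dder y k (pd b g) x"
    if "b \<in> Basis" for b
  proof -
    have "pd b (\<lambda>x. f x + c * g x) = (\<lambda>x. pd b f x + c * pd b g x)"
      by (intro ext pd_lin smooth_fun_differentiable Suc.prems)
    then show ?thesis
      using Suc.IH[OF smooth_fun_pd[OF Suc.prems(1) that] smooth_fun_pd[OF Suc.prems(2) that]] by simp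
  qed
  then show ?case by (simp add: sum.distrib sum_distrib_left algebra_simps)
qed simp

lemma dder_diff:
  assumes "smooth_fun f" "smooth_fun g"
  shows "dder y k (\<lambda>x. f x - g x) x = dder y k f x - dder y k g x"
  using dder_lin[OF assms, of y k "-1"] by simp

lemma pd_outside:
  assumes "closed K" "\<And>x. x \<notin> K \<Longrightarrow> f x = 0" "x \<notin> K"
  shows "pd b f x = 0"
proof -
  have "(f has_derivative (\<lambda>_. 0)) (at x)"
    by (rule has_derivative_transform_within_open[of "\<lambda>_. 0" _ _ _ "- K"]) (use assms in auto)
  then show ?thesis unfolding pd_def using frechet_derivative_at by metis
qed

lemma dder_outside:
  assumes "closed K" "\<And>x. x \<notin> K \<Longrightarrow> f x = 0" "x \<notin> K"
  shows "dder y k f x = 0"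
  using assms(2,3)
proof (induction k arbitrary: f x)
  case (Suc k)
  have "dder y k (pd b f) x = 0" for b
    by (rule Suc.IH) (use pd_outside[OF assms(1) Suc.prems(1)] Suc.prems in auto)
  then show ?case by simp
qed simp

text \<open>The inductions below replace \<open>f\<close> by its partial derivatives and by its
  negative Laplacian while \<open>g\<close> stays the same, so the two are kept apart;
  \<open>g\<close> becomes \<open>f\<close> only in the energy identity.\<close>

definition dder_pairing :: "('a::euclidean_space \<Rightarrow> complex) \<Rightarrow> nat \<Rightarrow> ('a \<Rightarrow> complex) \<Rightarrow> 'a \<Rightarrow> complex" where
  "dder_pairing g k f y = (\<integral>x. dder y k f x * cnj (g x) \<partial>lborel)"

context
  fixes g :: "'a::euclidean_space \<Rightarrow> complex" and K :: "'a set"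
  assumes g: "continuous_on UNIV g" and K: "compact K" and gK: "\<And>x. x \<notin> K \<Longrightarrow> g x = 0"
begin

lemma integrable_dder_cnj:
  assumes "smooth_fun f"
  shows "integrable lborel (\<lambda>x. dder y k f x * cnj (g x))"
  by (rule integrable_continuous_compact_support[OF _ K])
    (auto intro!: continuous_intros g dder_continuous assms simp: gK)

lemma dder_pairing_Suc:
  assumes "smooth_fun f"
  shows "dder_pairing g (Suc k) f y = (\<Sum>b\<in>Basis. of_real (y \<bullet> b) * dder_pairing g k (pd b f) y)"
proof -
  have "dder_pairing g (Suc k) f y
    = (\<integral>x. (\<Sum>b\<in>Basis. of_real (y \<bullet> b) * (dder y k (pd b f) x * cnj (g x))) \<partial>lborel)"
    unfolding dder_pairing_def by (simp add: sum_distrib_right mult.assoc)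
  also have "\<dots> = (\<Sum>b\<in>Basis. \<integral>x. of_real (y \<bullet> b) * (dder y k (pd b f) x * cnj (g x)) \<partial>lborel)"
    by (intro Bochner_Integration.integral_sum integrable_mult_right integrable_dder_cnj smooth_fun_pd assms)
  finally show ?thesis by (simp add: dder_pairing_def)
qed

lemma dder_pairing_bound:
  "smooth_fun f \<Longrightarrow> \<exists>C. \<forall>y. norm (dder_pairing g k f y) \<le> C * norm y ^ k"
proof (induction k arbitrary: f)
  case 0
  show ?case by (intro exI[of _ "norm (\<integral>x. f x * cnj (g x) \<partial>lborel)"]) (simp add: dder_pairing_def)
next
  case (Suc k)
  have "\<forall>b\<in>Basis. \<exists>C. \<forall>y. norm (dder_pairing g k (pd b f) y) \<le> C * norm y ^ k"
    using Suc.IH smooth_fun_pd[OF Suc.prems] by blast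
  then obtain C where C: "\<forall>b\<in>Basis. \<forall>y. norm (dder_pairing g k (pd b f) y) \<le> C b * norm y ^ k"
    unfolding bchoice_iff by (elim exE)
  have "norm (dder_pairing g (Suc k) f y) \<le> (\<Sum>b\<in>Basis. C b) * norm y ^ Suc k" for y
  proof -
    have "norm (dder_pairing g (Suc k) f y) \<le> (\<Sum>b\<in>Basis. norm (of_real (y \<bullet> b) * dder_pairing g k (pd b f) y))"
      unfolding dder_pairing_Suc[OF Suc.prems] by (rule norm_sum)
    also have "\<dots> \<le> (\<Sum>b\<in>Basis. norm y * (C b * norm y ^ k))"
      by (intro sum_mono) (use C Basis_le_norm in \<open>auto simp: norm_mult intro!: mult_mono\<close>)
    also have "\<dots> = (\<Sum>b\<in>Basis. C b) * norm y ^ Suc k"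
      by (simp add: sum_distrib_left sum_distrib_right mult_ac)
    finally show ?thesis .
  qed
  then show ?case by blast
qed

lemma continuous_on_dder_pairing: "smooth_fun f \<Longrightarrow> continuous_on A (dder_pairing g k f)"
proof (induction k arbitrary: f)
  case 0
  then show ?case by (simp add: dder_pairing_def)
next
  case (Suc k)
  then show ?case
    unfolding dder_pairing_Suc[OF Suc.prems, abs_def] by (intro continuous_intros Suc.IH smooth_fun_pd)
qed

text \<open>As a function of the direction, the pairing is a homogeneous polynomial; differentiating it
  pulls out one derivative, because partial derivatives commute.\<close>

lemma dder_pairing_has_vector_derivative:
  assumes "smooth_fun f" and c: "c \<in> Basis"
  shows "((\<lambda>t. dder_pairing g (Suc k) f (y + t *\<^sub>R c)) has_vector_derivative
    of_nat (Suc k) * dder_pairing g k (pd c f) (y + t *\<^sub>R c)) (at t)"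
  using assms(1)
proof (induction k arbitrary: f)
  case (0 f)
  define J where "J f = (\<integral>x. f x * cnj (g x) \<partial>lborel)" for f
  have J: "dder_pairing g 0 f y = J f" for f y by (simp add: dder_pairing_def J_def)
  have "((\<lambda>t. \<Sum>b\<in>Basis. of_real ((y + t *\<^sub>R c) \<bullet> b) * J (pd b f)) has_vector_derivative
      (\<Sum>b\<in>Basis. of_real (c \<bullet> b) * J (pd b f))) (at t)"
    by (auto intro!: derivative_eq_intros sum.cong simp: inner_simps)
  moreover have "(\<Sum>b\<in>Basis. of_real (c \<bullet> b) * J (pd b f)) = J (pd c f)"
    using c by (subst sum.remove[of _ c]) (auto simp: inner_Basis split: if_splits intro!: sum.neutral)
  ultimately show ?case unfolding dder_pairing_Suc[OF 0] by (simp add: J)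
next
  case (Suc k f)
  have d: "((\<lambda>t. of_real ((y + t *\<^sub>R c) \<bullet> b) * dder_pairing g (Suc k) (pd b f) (y + t *\<^sub>R c)) has_vector_derivative
      (of_real ((y + t *\<^sub>R c) \<bullet> b) * (of_nat (Suc k) * dder_pairing g k (pd c (pd b f)) (y + t *\<^sub>R c))
        + of_real (c \<bullet> b) * dder_pairing g (Suc k) (pd b f) (y + t *\<^sub>R c))) (at t)"
    if b: "b \<in> Basis" for b
  proof -
    have "((\<lambda>t. of_real ((y + t *\<^sub>R c) \<bullet> b) :: complex) has_vector_derivative of_real (c \<bullet> b)) (at t)"
      by (auto intro!: derivative_eq_intros simp: inner_simps)
    from has_vector_derivative_mult[OF this Suc.IH[OF smooth_fun_pd[OF Suc.prems b]]] show ?thesis .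
  qed
  have "((\<lambda>t. dder_pairing g (Suc (Suc k)) f (y + t *\<^sub>R c)) has_vector_derivative
     (\<Sum>b\<in>Basis. of_real ((y + t *\<^sub>R c) \<bullet> b) * (of_nat (Suc k) * dder_pairing g k (pd c (pd b f)) (y + t *\<^sub>R c))
        + of_real (c \<bullet> b) * dder_pairing g (Suc k) (pd b f) (y + t *\<^sub>R c))) (at t)"
    unfolding dder_pairing_Suc[OF Suc.prems] by (intro has_vector_derivative_sum d)
  also have "(\<Sum>b\<in>Basis. of_real ((y + t *\<^sub>R c) \<bullet> b) * (of_nat (Suc k) * dder_pairing g k (pd c (pd b f)) (y + t *\<^sub>R c))
        + of_real (c \<bullet> b) * dder_pairing g (Suc k) (pd b f) (y + t *\<^sub>R c))
      = of_nat (Suc k) * dder_pairing g (Suc k) (pd c f) (y + t *\<^sub>R c) + dder_pairing g (Suc k) (pd c f) (y + t *\<^sub>R c)"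
  proof -
    \<comment> \<open>Commuting puts the new derivative \<open>c\<close> innermost, so that the sum
      over \<open>b\<close> folds back into one pairing of \<open>pd c f\<close>. Together with the
      derivative of the linear coefficient this raises the factor from k + 1 to k + 2.\<close>
    have comm: "pd c (pd b f) = pd b (pd c f)" if "b \<in> Basis" for b
      using pd_commute[OF Suc.prems c that] by (intro ext)
    have "(\<Sum>b\<in>Basis. of_real (c \<bullet> b) * dder_pairing g (Suc k) (pd b f) (y + t *\<^sub>R c))
        = dder_pairing g (Suc k) (pd c f) (y + t *\<^sub>R c)"
      using c by (subst sum.remove[of _ c]) (auto simp: inner_Basis split: if_splits intro!: sum.neutral)
    moreover have "(\<Sum>b\<in>Basis. of_real ((y + t *\<^sub>R c) \<bullet> b) * (of_nat (Suc k) * dder_pairing g k (pd c (pd b f)) (y + t *\<^sub>R c)))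
        = of_nat (Suc k) * dder_pairing g (Suc k) (pd c f) (y + t *\<^sub>R c)"
      unfolding dder_pairing_Suc[OF smooth_fun_pd[OF Suc.prems c]] sum_distrib_left
      by (intro sum.cong refl) (simp only: comm mult.left_commute)
    ultimately show ?thesis by (simp only: sum.distrib)
  qed
  also have "\<dots> = of_nat (Suc (Suc k)) * dder_pairing g (Suc k) (pd c f) (y + t *\<^sub>R c)"
    by (simp add: algebra_simps)
  finally show ?case .
qed

lemma integrable_gauss_dder_pairing:
  assumes "smooth_fun f"
  shows "integrable lborel (\<lambda>y. gauss y *\<^sub>R dder_pairing g k f y)"
proof -
  obtain C where "\<And>y. norm (dder_pairing g k f y) \<le> C * norm y ^ k"
    using dder_pairing_bound[OF assms] by blast
  then show ?thesis by (rule integrable_poly_gauss[OF continuous_on_dder_pairing[OF assms]])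
qed

lemma dder_pairing_sum:
  assumes "\<And>i. i \<in> I \<Longrightarrow> smooth_fun (F i)" "finite I"
  shows "dder_pairing g k (\<lambda>x. \<Sum>i\<in>I. F i x) y = (\<Sum>i\<in>I. dder_pairing g k (F i) y)"
proof -
  have "dder y k (\<lambda>x. \<Sum>i\<in>I. F i x) x = (\<Sum>i\<in>I. dder y k (F i) x)" for x
    by (rule dder_sum) (use assms in auto)
  then have "dder_pairing g k (\<lambda>x. \<Sum>i\<in>I. F i x) y = (\<integral>x. (\<Sum>i\<in>I. dder y k (F i) x * cnj (g x)) \<partial>lborel)"
    by (simp add: dder_pairing_def sum_distrib_right)
  also have "\<dots> = (\<Sum>i\<in>I. dder_pairing g k (F i) y)"
    unfolding dder_pairing_def
    by (intro Bochner_Integration.integral_sum integrable_dder_cnj assms)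
  finally show ?thesis .
qed

lemma dder_pairing_uminus:
  assumes "smooth_fun f"
  shows "dder_pairing g k (\<lambda>x. - f x) y = - dder_pairing g k f y"
proof -
  have "dder y k (\<lambda>x. - f x) x = - dder y k f x" for x
    using dder_lin[OF assms assms, of y k "-2"] by simp
  then show ?thesis by (simp add: dder_pairing_def)
qed

text \<open>Expanding one derivative produces factors y . b, and Gaussian integration by parts turns
  each into a b-derivative of the remaining polynomial. That costs the factor k + 1 and applies
  \<open>pd b\<close> a second time; summing over b gives the Laplacian.\<close>

lemma gauss_dder_pairing_step:
  assumes f: "smooth_fun f"
  shows "(\<integral>y. gauss y *\<^sub>R dder_pairing g (Suc (Suc k)) f y \<partial>lborel)
    = - (of_nat (Suc k) * (\<integral>y. gauss y *\<^sub>R dder_pairing g k (\<lambda>x. - laplacian f x) y \<partial>lborel))"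
proof -
  have parts: "integrable lborel (\<lambda>y. gauss y *\<^sub>R (y \<bullet> b) *\<^sub>R dder_pairing g (Suc k) (pd b f) y)"
    "(\<integral>y. gauss y *\<^sub>R (y \<bullet> b) *\<^sub>R dder_pairing g (Suc k) (pd b f) y \<partial>lborel)
      = (\<integral>y. gauss y *\<^sub>R (of_nat (Suc k) * dder_pairing g k (pd b (pd b f)) y) \<partial>lborel)"
    if b: "b \<in> Basis" for b
  proof -
    have fb: "smooth_fun (pd b f)" and fbb: "smooth_fun (pd b (pd b f))"
      using f b by (auto intro: smooth_fun_pd)
    obtain C where C: "\<And>y. norm (dder_pairing g (Suc k) (pd b f) y) \<le> C * norm y ^ Suc k"
      using dder_pairing_bound[OF fb] by blast
    obtain C' where C': "\<And>y. norm (dder_pairing g k (pd b (pd b f)) y) \<le> C' * norm y ^ k"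
      using dder_pairing_bound[OF fbb] by blast
    have C'': "norm (of_nat (Suc k) * dder_pairing g k (pd b (pd b f)) y) \<le> (real (Suc k) * C') * norm y ^ k" for y
      using C'[of y] unfolding norm_mult norm_of_nat by (simp only: mult.assoc mult_left_mono of_nat_0_le_iff)
    have c: "continuous_on UNIV (\<lambda>y. of_nat (Suc k) * dder_pairing g k (pd b (pd b f)) y)"
      by (intro continuous_intros continuous_on_dder_pairing fbb)
    note by_parts = gauss_by_parts[where P = "dder_pairing g (Suc k) (pd b f)"
      and P' = "\<lambda>y. of_nat (Suc k) * dder_pairing g k (pd b (pd b f)) y",
      OF b continuous_on_dder_pairing[OF fb] C c C'' dder_pairing_has_vector_derivative[OF fb b]]
    show "integrable lborel (\<lambda>y. gauss y *\<^sub>R (y \<bullet> b) *\<^sub>R dder_pairing g (Suc k) (pd b f) y)"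
      by (rule by_parts(1))
    show "(\<integral>y. gauss y *\<^sub>R (y \<bullet> b) *\<^sub>R dder_pairing g (Suc k) (pd b f) y \<partial>lborel)
      = (\<integral>y. gauss y *\<^sub>R (of_nat (Suc k) * dder_pairing g k (pd b (pd b f)) y) \<partial>lborel)"
      by (rule by_parts(2))
  qed
  have int: "integrable lborel (\<lambda>y. gauss y *\<^sub>R (of_nat (Suc k) * dder_pairing g k (pd b (pd b f)) y))"
    if "b \<in> Basis" for b
    using integrable_mult_right[OF integrable_gauss_dder_pairing[OF smooth_fun_pd[OF smooth_fun_pd[OF f that] that], of k], of "of_nat (Suc k)"]
    by (simp only: mult_scaleR_right)
  have "(\<integral>y. gauss y *\<^sub>R dder_pairing g (Suc (Suc k)) f y \<partial>lborel)
    = (\<integral>y. (\<Sum>b\<in>Basis. gauss y *\<^sub>R (y \<bullet> b) *\<^sub>R dder_pairing g (Suc k) (pd b f) y) \<partial>lborel)"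
    unfolding dder_pairing_Suc[OF f, of "Suc k"] by (simp only: scaleR_conv_of_real sum_distrib_left)
  also have "\<dots> = (\<Sum>b\<in>Basis. \<integral>y. gauss y *\<^sub>R (y \<bullet> b) *\<^sub>R dder_pairing g (Suc k) (pd b f) y \<partial>lborel)"
    by (intro Bochner_Integration.integral_sum parts(1))
  also have "\<dots> = (\<Sum>b\<in>Basis. \<integral>y. gauss y *\<^sub>R (of_nat (Suc k) * dder_pairing g k (pd b (pd b f)) y) \<partial>lborel)"
    by (intro sum.cong refl parts(2))
  also have "\<dots> = (\<integral>y. (\<Sum>b\<in>Basis. gauss y *\<^sub>R (of_nat (Suc k) * dder_pairing g k (pd b (pd b f)) y)) \<partial>lborel)"
    by (intro Bochner_Integration.integral_sum[symmetric] int)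
  also have "\<dots> = (\<integral>y. - (of_nat (Suc k) * (gauss y *\<^sub>R dder_pairing g k (\<lambda>x. - laplacian f x) y)) \<partial>lborel)"
  proof (intro Bochner_Integration.integral_cong refl)
    fix y
    have "dder_pairing g k (\<lambda>x. - laplacian f x) y = - (\<Sum>b\<in>Basis. dder_pairing g k (pd b (pd b f)) y)"
      unfolding dder_pairing_uminus[OF smooth_fun_laplacian[OF f]] unfolding laplacian_def
      by (subst dder_pairing_sum) (auto intro: smooth_fun_pd f)
    then show "(\<Sum>b\<in>Basis. gauss y *\<^sub>R (of_nat (Suc k) * dder_pairing g k (pd b (pd b f)) y))
      = - (of_nat (Suc k) * (gauss y *\<^sub>R dder_pairing g k (\<lambda>x. - laplacian f x) y))"
      by (simp only: scaleR_conv_of_real sum_distrib_left mult_minus_right minus_minus mult.left_commute)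
  qed
  also have "\<dots> = - (of_nat (Suc k) * (\<integral>y. gauss y *\<^sub>R dder_pairing g k (\<lambda>x. - laplacian f x) y \<partial>lborel))"
    by (simp only: integral_minus integral_mult_right_zero)
  finally show ?thesis .
qed

text \<open>Two degrees in \<open>y\<close> disappear per step, at the cost of the next odd number
  and a sign. At degree 0 the pairing does not depend on \<open>y\<close>, and the mass of the
  Gaussian remains.\<close>

lemma gauss_dder_pairing:
  "smooth_fun f \<Longrightarrow> (\<integral>y. gauss y *\<^sub>R dder_pairing g (2 * m) f y \<partial>lborel)
    = (-1) ^ m * of_real ((\<Prod>k<m. real (2 * k + 1)) * gauss_mass TYPE('a)) * (\<integral>x. neg_lap_pow m f x * cnj (g x) \<partial>lborel)"
proof (induction m arbitrary: f)
  case 0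
  have "(\<integral>y. gauss y *\<^sub>R dder_pairing g 0 f y \<partial>lborel) = (\<integral>y. gauss y *\<^sub>R dder_pairing g 0 f 0 \<partial>(lborel :: 'a measure))"
    by (simp add: dder_pairing_def)
  also have "\<dots> = gauss_mass TYPE('a) *\<^sub>R dder_pairing g 0 f 0"
    by (simp add: gauss_mass_def integrable_gauss)
  finally show ?case by (simp add: dder_pairing_def neg_lap_pow_def scaleR_conv_of_real)
next
  case (Suc m)
  have s: "smooth_fun (\<lambda>x. - laplacian f x)"
    by (intro smooth_fun_uminus smooth_fun_laplacian Suc.prems)
  \<comment> \<open>The iterate is unfolded at its innermost factor, so the induction hypothesis
    applies to the negative Laplacian of \<open>f\<close> with the same \<open>g\<close>.\<close>
  have n: "neg_lap_pow (Suc m) f = neg_lap_pow m (\<lambda>x. - laplacian f x)"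
    unfolding neg_lap_pow_def funpow_Suc_right by simp
  have "(\<integral>y. gauss y *\<^sub>R dder_pairing g (2 * Suc m) f y \<partial>lborel)
     = - (of_nat (Suc (2 * m)) * (\<integral>y. gauss y *\<^sub>R dder_pairing g (2 * m) (\<lambda>x. - laplacian f x) y \<partial>lborel))"
    using gauss_dder_pairing_step[OF Suc.prems, of "2 * m"] by simp
  also have "\<dots> = (-1) ^ Suc m * of_real ((\<Prod>k<Suc m. real (2 * k + 1)) * gauss_mass TYPE('a))
      * (\<integral>x. neg_lap_pow (Suc m) f x * cnj (g x) \<partial>lborel)"
    unfolding Suc.IH[OF s] n by (simp add: algebra_simps)
  finally show ?case .
qed

end

lemma dder_by_parts:
  assumes f: "smooth_fun f" and g: "smooth_fun g" and K: "compact K" "\<And>x. x \<notin> K \<Longrightarrow> g x = 0"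
  shows "(\<integral>x. dder y (Suc k) f x * cnj (dder y j g x) \<partial>lborel)
    = - (\<integral>x. dder y k f x * cnj (dder y (Suc j) g x) \<partial>lborel)"
proof -
  have int: "integrable lborel (\<lambda>x. dder y k f x * cnj (dder y j g x))" for k j
    by (rule integrable_continuous_compact_support[OF _ K(1)])
      (auto intro!: continuous_intros dder_continuous f g simp: dder_outside[OF compact_imp_closed[OF K(1)] K(2)])
  have "(\<integral>x. dder y k f x * cnj (dder y (Suc j) g x) + dder y (Suc k) f x * cnj (dder y j g x) \<partial>lborel) = 0"
  proof (rule integral_directional_derivative_eq_0[where h = "\<lambda>x. dder y k f x * cnj (dder y j g x)" and y = y])
    show "((\<lambda>t. dder y k f (x + t *\<^sub>R y) * cnj (dder y j g (x + t *\<^sub>R y))) has_vector_derivative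
      dder y k f (x + t *\<^sub>R y) * cnj (dder y (Suc j) g (x + t *\<^sub>R y)) + dder y (Suc k) f (x + t *\<^sub>R y) * cnj (dder y j g (x + t *\<^sub>R y))) (at t)"
      for x t
      by (rule has_vector_derivative_mult[OF dder_has_vector_derivative[OF f]
        bounded_linear.has_vector_derivative[OF bounded_linear_cnj dder_has_vector_derivative[OF g]]])
  qed (intro int Bochner_Integration.integrable_add continuous_intros dder_continuous f g)+
  then show ?thesis
    unfolding Bochner_Integration.integral_add[OF int int] by (simp only: add_eq_0_iff)
qed

lemma dder_by_parts_iterated:
  assumes f: "smooth_fun f" and g: "smooth_fun g" and K: "compact K" "\<And>x. x \<notin> K \<Longrightarrow> g x = 0"
  shows "(\<integral>x. dder y (k + j) f x * cnj (dder y i g x) \<partial>lborel)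
    = (-1) ^ j * (\<integral>x. dder y k f x * cnj (dder y (i + j) g x) \<partial>lborel)"
proof (induction j arbitrary: i)
  case (Suc j)
  show ?case
    using dder_by_parts[OF f g K, of y "k + j" i] Suc.IH[of "Suc i"] by simp
qed simp

section \<open>The energy of a directional derivative and its Gaussian mean\<close>

definition dder_energy :: "nat \<Rightarrow> ('a::euclidean_space \<Rightarrow> complex) \<Rightarrow> 'a \<Rightarrow> real" where
  "dder_energy m f y = (\<integral>x. (cmod (dder y m f x))\<^sup>2 \<partial>lborel)"

lemma test_fun_support:
  assumes "test_fun \<Omega> f"
  shows "\<exists>K. compact K \<and> K \<subseteq> \<Omega> \<and> (\<forall>x. x \<notin> K \<longrightarrow> f x = 0)"
proof (intro exI conjI allI impI)
  show "compact (closure {x. f x \<noteq> 0})" "closure {x. f x \<noteq> 0} \<subseteq> \<Omega>"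
    using assms by (auto simp: test_fun_def)
  show "f x = 0" if "x \<notin> closure {x. f x \<noteq> 0}" for x
    using that closure_subset[of "{x. f x \<noteq> 0}"] by auto
qed

lemma integrable_dder_square:
  assumes f: "smooth_fun f" and K: "compact K" "\<And>x. x \<notin> K \<Longrightarrow> f x = 0"
  shows "integrable lborel (\<lambda>x. (cmod (dder y m f x))\<^sup>2)"
  by (rule integrable_continuous_compact_support[OF _ K(1)])
    (auto intro!: continuous_intros dder_continuous f simp: dder_outside[OF compact_imp_closed[OF K(1)] K(2)])

text \<open>Move half of the 2m derivatives onto the second factor. This exhibits the energy as a
  polynomial in the direction, the form in which its Gaussian mean has been computed.\<close>

lemma dder_energy_eq_pairing:
  assumes f: "smooth_fun f" and K: "compact K" "\<And>x. x \<notin> K \<Longrightarrow> f x = 0"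
  shows "of_real (dder_energy m f y) = (-1) ^ m * dder_pairing f (2 * m) f y"
proof -
  have "dder_pairing f (2 * m) f y = (-1) ^ m * (\<integral>x. dder y m f x * cnj (dder y m f x) \<partial>lborel)"
    using dder_by_parts_iterated[OF f f K, of y m m 0] by (simp add: dder_pairing_def mult_2)
  also have "(\<integral>x. dder y m f x * cnj (dder y m f x) \<partial>lborel) = of_real (dder_energy m f y)"
    unfolding dder_energy_def complex_norm_square[symmetric] by (rule integral_complex_of_real)
  finally show ?thesis by (simp add: mult.assoc[symmetric] power_add[symmetric] mult_2[symmetric])
qed

text \<open>The sign (-1)^m of the energy identity cancels that of
  \<open>gauss_dder_pairing\<close>. Taking real parts of the resulting complex identity matches the
  real part in \<open>Qm\<close>.\<close>

lemma gauss_dder_energy: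
  fixes f :: "'a::euclidean_space \<Rightarrow> complex"
  assumes f: "test_fun \<Omega> f"
  shows "integrable lborel (\<lambda>y. gauss y * dder_energy m f y)"
    and "(\<integral>y. gauss y * dder_energy m f y \<partial>lborel) = (\<Prod>k<m. real (2 * k + 1)) * gauss_mass TYPE('a) * Qm m f"
proof -
  obtain K where K': "compact K" "K \<subseteq> \<Omega>" "\<And>x. x \<notin> K \<Longrightarrow> f x = 0" using test_fun_support[OF f] by blast
  note K = K'(1,3)
  have s: "smooth_fun f" using f by (simp add: test_fun_def)
  have cf: "continuous_on UNIV f" by (rule smooth_fun_continuous[OF s])
  have eq: "of_real (gauss y * dder_energy m f y) = (-1) ^ m * (gauss y *\<^sub>R dder_pairing f (2 * m) f y)" for y
    using dder_energy_eq_pairing[OF s K] by (simp add: scaleR_conv_of_real)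
  have "integrable lborel (\<lambda>y. complex_of_real (gauss y * dder_energy m f y))"
    unfolding eq by (intro integrable_mult_right integrable_gauss_dder_pairing[OF cf K] s)
  from integrable_Re[OF this] show "integrable lborel (\<lambda>y. gauss y * dder_energy m f y)"
    by (simp only: Re_complex_of_real)
  have "complex_of_real (\<integral>y. gauss y * dder_energy m f y \<partial>lborel)
     = (\<integral>y. (-1) ^ m * (gauss y *\<^sub>R dder_pairing f (2 * m) f y) \<partial>lborel)"
    unfolding eq[symmetric] by (rule integral_complex_of_real[symmetric])
  also have "\<dots> = (-1) ^ m * (\<integral>y. gauss y *\<^sub>R dder_pairing f (2 * m) f y \<partial>lborel)"
    by (rule integral_mult_right_zero)
  also have "\<dots> = of_real ((\<Prod>k<m. real (2 * k + 1)) * gauss_mass TYPE('a)) * (\<integral>x. neg_lap_pow m f x * cnj (f x) \<partial>lborel)"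
  proof -
    have "(\<integral>y. gauss y *\<^sub>R dder_pairing f (2 * m) f y \<partial>lborel)
      = (-1) ^ m * of_real ((\<Prod>k<m. real (2 * k + 1)) * gauss_mass TYPE('a)) * (\<integral>x. neg_lap_pow m f x * cnj (f x) \<partial>lborel)"
      by (rule gauss_dder_pairing[OF cf K(1) _ s]) (rule K(2))
    then show ?thesis
      by (simp only: mult.assoc[symmetric] power_mult_distrib[symmetric]) simp
  qed
  finally have "Re (complex_of_real (\<integral>y. gauss y * dder_energy m f y \<partial>lborel))
    = Re (of_real ((\<Prod>k<m. real (2 * k + 1)) * gauss_mass TYPE('a)) * (\<integral>x. neg_lap_pow m f x * cnj (f x) \<partial>lborel))"
    by (rule arg_cong)
  then show "(\<integral>y. gauss y * dder_energy m f y \<partial>lborel) = (\<Prod>k<m. real (2 * k + 1)) * gauss_mass TYPE('a) * Qm m f"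
    unfolding Qm_def Re_complex_of_real by (simp only: times_complex.sel Re_complex_of_real Im_complex_of_real mult_zero_left diff_zero)
qed

section \<open>Polar coordinates\<close>

lemma nn_integral_lborel_scale:
  fixes f :: "'a::euclidean_space \<Rightarrow> ennreal"
  assumes f[measurable]: "f \<in> borel_measurable borel" and "0 < R"
  shows "(\<integral>\<^sup>+y. f y \<partial>lborel) = ennreal (R ^ DIM('a)) * (\<integral>\<^sup>+y. f (R *\<^sub>R y) \<partial>lborel)"
proof -
  have "(lborel :: 'a measure) = density (distr lborel borel (\<lambda>x. 0 + R *\<^sub>R x)) (\<lambda>_. ennreal (\<bar>R\<bar> ^ DIM('a)))"
    using \<open>0 < R\<close> lborel_affine[of R "0::'a"] by (simp add: ennreal_power)
  then have "(\<integral>\<^sup>+y. f y \<partial>lborel) = (\<integral>\<^sup>+y. f y \<partial>density (distr lborel borel (\<lambda>x. 0 + R *\<^sub>R x)) (\<lambda>_. ennreal (\<bar>R\<bar> ^ DIM('a))))"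
    by (rule arg_cong)
  also have "\<dots> = (\<integral>\<^sup>+y. ennreal (\<bar>R\<bar> ^ DIM('a)) * f y \<partial>distr lborel borel (\<lambda>x. 0 + R *\<^sub>R x))"
    by (rule nn_integral_density) auto
  also have "\<dots> = (\<integral>\<^sup>+y. ennreal (\<bar>R\<bar> ^ DIM('a)) * f (0 + R *\<^sub>R y) \<partial>lborel)"
    by (rule nn_integral_distr) auto
  also have "\<dots> = ennreal (R ^ DIM('a)) * (\<integral>\<^sup>+y. f (R *\<^sub>R y) \<partial>lborel)"
    using \<open>0 < R\<close> by (simp add: nn_integral_cmult)
  finally show ?thesis .
qed

lemma borel_measurable_sgn_euclidean [measurable]: "(sgn :: 'a::euclidean_space \<Rightarrow> 'a) \<in> borel_measurable borel"
  unfolding sgn_div_norm by measurable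

lemma sgn_scaleR_pos: "0 < R \<Longrightarrow> sgn (R *\<^sub>R y) = sgn (y :: 'a::real_normed_vector)"
  by (simp add: sgn_scaleR)

lemma emeasure_unit_ball: "emeasure lborel (ball (0::'a::euclidean_space) 1) \<noteq> 0"
  "emeasure lborel (ball (0::'a::euclidean_space) 1) \<noteq> \<infinity>"
proof -
  have "emeasure lborel (ball (0::'a) 1) = emeasure lebesgue (ball (0::'a) 1)" by simp
  moreover have "\<not> negligible (ball (0::'a) 1)" by (simp add: open_not_negligible)
  ultimately show "emeasure lborel (ball (0::'a) 1) \<noteq> 0"
    by (simp add: negligible_iff_null_sets null_sets_def)
  show "emeasure lborel (ball (0::'a) 1) \<noteq> \<infinity>"
    using emeasure_lborel_ball_finite[of "0::'a" 1] by simp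
qed

lemma sets_sphere_measure [measurable_cong]: "sets sphere_measure = sets borel"
  by (simp add: sphere_measure_def)

lemma prob_space_sphere_measure: "prob_space (sphere_measure :: 'a::euclidean_space measure)"
  unfolding sphere_measure_def
  by (intro prob_space.prob_space_distr prob_space_uniform_measure emeasure_unit_ball) simp

text \<open>\<open>sphere_measure\<close> is built from the unit ball; scaling Lebesgue measure
  carries this to radius R because \<open>sgn\<close> is invariant under positive scaling. At the
  origin \<open>sgn\<close> and the projection in the definition are both 0, so no point has to be
  removed.\<close>

lemma emeasure_sphere_measure:
  fixes A :: "'a::euclidean_space set"
  assumes [measurable]: "A \<in> sets borel" and "0 < R"
  shows "emeasure lborel {y. sgn y \<in> A \<and> norm y < R} = emeasure sphere_measure A * emeasure lborel (ball (0::'a) R)"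
proof -
  have bs: "ball (0::'a) r = {y. norm y < r}" for r by auto
  have "emeasure sphere_measure A = emeasure (uniform_measure lborel (ball 0 1)) ((\<lambda>y::'a. sgn y) -` A)"
    unfolding sphere_measure_def sgn_div_norm[symmetric]
    by (subst emeasure_distr) (auto simp: sgn_div_norm)
  also have "\<dots> = emeasure lborel (ball 0 1 \<inter> (\<lambda>y::'a. sgn y) -` A) / emeasure lborel (ball (0::'a) 1)"
    by (rule emeasure_uniform_measure) (auto intro: measurable_sets_borel[OF borel_measurable_sgn_euclidean])
  also have "ball 0 1 \<inter> (\<lambda>y::'a. sgn y) -` A = {y. sgn y \<in> A \<and> norm y < 1}" by auto
  finally have 1: "emeasure sphere_measure A * emeasure lborel (ball (0::'a) 1) = emeasure lborel {y. sgn y \<in> A \<and> norm y < 1}"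
    using emeasure_unit_ball[where 'a='a] by (simp add: ennreal_divide_times ennreal_times_divide mult_divide_eq_ennreal)
  have sc: "emeasure lborel {y. sgn y \<in> B \<and> norm y < R} = ennreal (R ^ DIM('a)) * emeasure lborel {y. sgn y \<in> B \<and> norm y < 1}"
    if [measurable]: "B \<in> sets borel" for B :: "'a set"
  proof -
    have "emeasure lborel {y. sgn y \<in> B \<and> norm y < r} = (\<integral>\<^sup>+y. indicator {y. sgn y \<in> B \<and> norm y < r} y \<partial>lborel)" for r :: real
      by (rule nn_integral_indicator[symmetric]) measurable
    note em = this
    have "(\<integral>\<^sup>+y. indicator {y. sgn y \<in> B \<and> norm y < R} y \<partial>lborel)
      = ennreal (R ^ DIM('a)) * (\<integral>\<^sup>+y. indicator {y. sgn y \<in> B \<and> norm y < R} (R *\<^sub>R y) \<partial>lborel)"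
      by (rule nn_integral_lborel_scale[OF _ \<open>0 < R\<close>]) measurable
    also have "(\<lambda>y. indicator {y. sgn y \<in> B \<and> norm y < R} (R *\<^sub>R y) :: ennreal) = indicator {y. sgn y \<in> B \<and> norm y < 1}"
      using \<open>0 < R\<close> by (auto simp: indicator_def fun_eq_iff sgn_scaleR_pos)
    finally show ?thesis unfolding em .
  qed
  have "emeasure lborel (ball (0::'a) R) = ennreal (R ^ DIM('a)) * emeasure lborel (ball (0::'a) 1)"
    using sc[of UNIV] by (simp add: bs)
  then show ?thesis
    unfolding sc[OF assms(1)] 1[symmetric] by (simp add: mult_ac)
qed

text \<open>For fixed \<open>A\<close> both sides are measures in \<open>B\<close>. They agree on
  the half-lines {..<r}, which amounts to the statement for balls, and these form an
  intersection-stable generator on which the measures are finite.\<close>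

lemma emeasure_polar:
  fixes A :: "'a::euclidean_space set"
  assumes A[measurable]: "A \<in> sets borel" and B: "B \<in> sets borel"
  shows "emeasure lborel {y. sgn y \<in> A \<and> norm y \<in> B} = emeasure sphere_measure A * emeasure lborel {y::'a. norm y \<in> B}"
proof -
  interpret S: prob_space "sphere_measure :: 'a measure" by (rule prob_space_sphere_measure)
  define M1 where "M1 = distr (density lborel (indicator {y::'a. sgn y \<in> A})) borel norm"
  define M2 where "M2 = scale_measure (emeasure sphere_measure A) (distr (lborel :: 'a measure) borel norm)"
  have e1: "emeasure M1 C = emeasure lborel {y. sgn y \<in> A \<and> norm y \<in> C}" if [measurable]: "C \<in> sets borel" for C
  proof -
    have "emeasure M1 C = emeasure (density lborel (indicator {y::'a. sgn y \<in> A})) (norm -` C)"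
      unfolding M1_def by (subst emeasure_distr) auto
    also have "\<dots> = (\<integral>\<^sup>+y. indicator {y::'a. sgn y \<in> A} y * indicator (norm -` C) y \<partial>lborel)"
      by (rule emeasure_density) (auto intro: measurable_sets_borel[OF borel_measurable_norm])
    also have "\<dots> = (\<integral>\<^sup>+y. indicator {y::'a. sgn y \<in> A \<and> norm y \<in> C} y \<partial>lborel)"
      by (intro nn_integral_cong) (auto simp: indicator_def)
    also have "\<dots> = emeasure lborel {y. sgn y \<in> A \<and> norm y \<in> C}"
      by (rule nn_integral_indicator) measurable
    finally show ?thesis .
  qed
  have e2: "emeasure M2 C = emeasure sphere_measure A * emeasure lborel {y::'a. norm y \<in> C}" if "C \<in> sets borel" for C
    using that unfolding M2_def by (simp add: emeasure_distr vimage_def)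
  have "M1 = M2"
  proof (rule measure_eqI_generator_eq[where E = "range lessThan" and \<Omega> = UNIV and A = "\<lambda>n. {..<real n}"])
    show "Int_stable (range lessThan :: real set set)"
    proof (rule Int_stableI)
      fix X Y :: "real set" assume "X \<in> range lessThan" "Y \<in> range lessThan"
      then obtain a b where "X = {..<a}" "Y = {..<b}" by blast
      then have "X \<inter> Y = {..<min a b}" by auto
      then show "X \<inter> Y \<in> range lessThan" by blast
    qed
    have "sets borel = sigma_sets UNIV (range lessThan :: real set set)"
      by (subst borel_Iio) simp
    then show "sets M1 = sigma_sets UNIV (range lessThan)" "sets M2 = sigma_sets UNIV (range lessThan)"
      by (simp_all add: M1_def M2_def)
    show "emeasure M1 X = emeasure M2 X" if "X \<in> range lessThan" for X :: "real set"
    proof -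
      from that obtain r where X: "X = {..<r}" by auto
      show ?thesis
      proof (cases "0 < r")
        case True
        then show ?thesis
          using emeasure_sphere_measure[OF A True] by (simp add: X e1 e2 ball_def dist_norm)
      next
        case False
        then have "\<not> norm y < r" for y :: 'a by (smt (verit) norm_ge_zero)
        then show ?thesis by (simp add: X e1 e2)
      qed
    qed
    show "(\<Union>i. {..<real i}) = UNIV" by (auto intro: reals_Archimedean2)
    show "emeasure M1 {..<real i} \<noteq> \<infinity>" for i
    proof -
      have "emeasure M1 {..<real i} \<le> emeasure lborel (ball (0::'a) (real i))"
        by (subst e1) (auto intro!: emeasure_mono)
      also have "\<dots> < \<infinity>" by (rule emeasure_lborel_ball_finite)
      finally show ?thesis by simp
    qed
  qed auto
  then show ?thesis using e1[OF B] e2[OF B] by simp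
qed

text \<open>Direction and norm together map Lebesgue measure to a product measure, since rectangles
  are settled by \<open>emeasure_polar\<close>. The radial factor is kept as the image under the
  norm, without an explicit density, because only a Gaussian moment will be evaluated against
  it.\<close>

lemma nn_integral_polar:
  fixes \<Phi> :: "'a::euclidean_space \<Rightarrow> ennreal"
  assumes [measurable]: "\<Phi> \<in> borel_measurable borel" "v \<in> borel_measurable borel"
  shows "(\<integral>\<^sup>+y. \<Phi> (sgn y) * v (norm y) \<partial>lborel) = (\<integral>\<^sup>+\<omega>. \<Phi> \<omega> \<partial>sphere_measure) * (\<integral>\<^sup>+y. v (norm (y::'a)) \<partial>lborel)"
proof -
  interpret S: prob_space "sphere_measure :: 'a measure" by (rule prob_space_sphere_measure)
  define M2 where "M2 = distr (lborel :: 'a measure) borel norm"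
  have [measurable_cong]: "sets M2 = sets borel" by (simp add: M2_def)
  have sf: "sigma_finite_measure M2"
  proof
    have "emeasure M2 {..<real i} \<noteq> \<infinity>" for i
    proof -
      have "emeasure M2 {..<real i} \<le> emeasure lborel (ball (0::'a) (real i))"
        unfolding M2_def by (subst emeasure_distr) (auto intro!: emeasure_mono)
      also have "\<dots> < \<infinity>" by (rule emeasure_lborel_ball_finite)
      finally show ?thesis by simp
    qed
    then show "\<exists>A. countable A \<and> A \<subseteq> sets M2 \<and> \<Union>A = space M2 \<and> (\<forall>a\<in>A. emeasure M2 a \<noteq> \<infinity>)"
      by (intro exI[of _ "range (\<lambda>i. {..<real i})"]) (auto simp: M2_def intro: reals_Archimedean2)
  qed
  interpret M2: sigma_finite_measure M2 by (rule sf)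
  define M where "M = distr (lborel :: 'a measure) (borel \<Otimes>\<^sub>M borel) (\<lambda>y. (sgn y, norm y))"
  have pair: "sphere_measure \<Otimes>\<^sub>M M2 = M"
  proof (rule pair_measure_eqI[OF S.sigma_finite_measure_axioms sf])
    show "sets (sphere_measure \<Otimes>\<^sub>M M2) = sets M"
      unfolding M_def sets_distr by (intro sets_pair_measure_cong) (simp_all add: sets_sphere_measure M2_def)
    show "emeasure sphere_measure A * emeasure M2 B = emeasure M (A \<times> B)"
      if "A \<in> sets sphere_measure" "B \<in> sets M2" for A B
    proof -
      have [measurable]: "A \<in> sets borel" "B \<in> sets borel" using that by (simp_all add: sets_sphere_measure M2_def)
      have "emeasure M (A \<times> B) = emeasure lborel {y. sgn y \<in> A \<and> norm y \<in> B}"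
        unfolding M_def by (subst emeasure_distr) (auto simp: vimage_def)
      also have "\<dots> = emeasure sphere_measure A * emeasure lborel {y::'a. norm y \<in> B}"
        by (rule emeasure_polar) auto
      also have "emeasure lborel {y::'a. norm y \<in> B} = emeasure M2 B"
        unfolding M2_def by (subst emeasure_distr) (auto simp: vimage_def)
      finally show ?thesis by simp
    qed
  qed
  have "(\<integral>\<^sup>+y. \<Phi> (sgn y) * v (norm y) \<partial>lborel) = (\<integral>\<^sup>+p. \<Phi> (fst p) * v (snd p) \<partial>M)"
    unfolding M_def by (subst nn_integral_distr) auto
  also have "\<dots> = (\<integral>\<^sup>+\<omega>. \<integral>\<^sup>+r. \<Phi> \<omega> * v r \<partial>M2 \<partial>sphere_measure)"
    unfolding pair[symmetric] by (subst M2.nn_integral_fst[symmetric]) auto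
  also have "\<dots> = (\<integral>\<^sup>+\<omega>. \<Phi> \<omega> \<partial>sphere_measure) * (\<integral>\<^sup>+r. v r \<partial>M2)"
    by (simp add: nn_integral_cmult nn_integral_multc)
  also have "(\<integral>\<^sup>+r. v r \<partial>M2) = (\<integral>\<^sup>+y. v (norm (y::'a)) \<partial>lborel)"
    unfolding M2_def by (subst nn_integral_distr) auto
  finally show ?thesis .
qed

section \<open>The directional distance\<close>

lemma INF_cmult_ennreal:
  fixes f :: "'b \<Rightarrow> ennreal"
  assumes "0 < c"
  shows "(INF s\<in>S. ennreal c * f s) = ennreal c * (INF s\<in>S. f s)"
proof (rule antisym)
  have c: "ennreal c * ennreal (1 / c) = 1" using assms by (simp add: ennreal_mult'[symmetric])
  have "ennreal (1 / c) * (INF s\<in>S. ennreal c * f s) \<le> (INF s\<in>S. f s)"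
  proof (rule INF_greatest)
    fix s assume "s \<in> S"
    then have "ennreal (1 / c) * (INF s\<in>S. ennreal c * f s) \<le> ennreal (1 / c) * (ennreal c * f s)"
      by (intro mult_left_mono INF_lower) auto
    also have "\<dots> = f s" using c by (simp add: mult.assoc[symmetric] mult.commute)
    finally show "ennreal (1 / c) * (INF s\<in>S. ennreal c * f s) \<le> f s" .
  qed
  then have "ennreal c * (ennreal (1 / c) * (INF s\<in>S. ennreal c * f s)) \<le> ennreal c * (INF s\<in>S. f s)"
    by (rule mult_left_mono) simp
  then show "(INF s\<in>S. ennreal c * f s) \<le> ennreal c * (INF s\<in>S. f s)"
    using c by (simp add: mult.assoc[symmetric])
  show "ennreal c * (INF s\<in>S. f s) \<le> (INF s\<in>S. ennreal c * f s)"
    by (intro INF_greatest mult_left_mono INF_lower) auto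
qed

text \<open>For a vector that is not a unit vector \<open>dist_dir\<close> measures the parameter
  and not the length, hence the factor \<open>norm y\<close>.\<close>

lemma dist_dir_sgn:
  assumes "y \<noteq> 0"
  shows "dist_dir \<Omega> (sgn y) x = ennreal (norm y) * dist_dir \<Omega> y x"
proof -
  have e: "(norm y * s) *\<^sub>R sgn y = s *\<^sub>R y" for s
  proof -
    have "norm y * s * inverse (norm y) = s" using assms by simp
    then show ?thesis by (simp only: sgn_div_norm scaleR_scaleR)
  qed
  have "{s. x + s *\<^sub>R sgn y \<notin> \<Omega>} = (\<lambda>s. norm y * s) ` {s. x + s *\<^sub>R y \<notin> \<Omega>}"
  proof (intro set_eqI iffI)
    fix s assume "s \<in> {s. x + s *\<^sub>R sgn y \<notin> \<Omega>}"
    then show "s \<in> (\<lambda>s. norm y * s) ` {s. x + s *\<^sub>R y \<notin> \<Omega>}"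
      using assms e[of "s / norm y"] by (intro image_eqI[of _ _ "s / norm y"]) auto
  qed (auto simp: e)
  then have "dist_dir \<Omega> (sgn y) x = (INF s\<in>{s. x + s *\<^sub>R y \<notin> \<Omega>}. ennreal (norm y) * ennreal \<bar>s\<bar>)"
    unfolding dist_dir_def by (simp add: image_image abs_mult ennreal_mult)
  also have "\<dots> = ennreal (norm y) * dist_dir \<Omega> y x"
    unfolding dist_dir_def using assms by (intro INF_cmult_ennreal) simp
  finally show ?thesis .
qed

text \<open>The factor c is positive and finite, so the inverse of the product splits even when the
  distance is 0 or top.\<close>

lemma inverse_dist_dir_sgn:
  assumes "y \<noteq> 0"
  shows "inverse (dist_dir \<Omega> y x ^ n) = inverse (dist_dir \<Omega> (sgn y) x ^ n) * ennreal (norm y ^ n)"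
proof -
  define c where "c = norm y ^ n"
  have c: "0 < c" using assms by (simp add: c_def)
  have "inverse (dist_dir \<Omega> (sgn y) x ^ n) = inverse (ennreal c * dist_dir \<Omega> y x ^ n)"
    unfolding dist_dir_sgn[OF assms] power_mult_distrib c_def by (simp add: ennreal_power)
  also have "\<dots> = inverse (ennreal c) * inverse (dist_dir \<Omega> y x ^ n)"
    using c by (intro ennreal_inverse_mult') auto
  also have "\<dots> * ennreal c = (inverse (ennreal c) * ennreal c) * inverse (dist_dir \<Omega> y x ^ n)"
    by (simp add: mult_ac)
  also have "inverse (ennreal c) * ennreal c = 1"
    using c by (simp add: inverse_ennreal ennreal_mult'[symmetric])
  finally show ?thesis by (simp add: c_def)
qed

text \<open>The parameters range over a compact interval: along a convergent sequence of pairs a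
  subsequence of them converges, and the limiting point stays in the closed complement.\<close>

lemma closed_dist_dir:
  fixes \<Omega> :: "'a::euclidean_space set"
  assumes "open \<Omega>"
  shows "closed {p. \<exists>s\<in>{-r..r}. fst p + s *\<^sub>R snd p \<notin> \<Omega>}"
  unfolding closed_sequential_limits
proof (intro allI impI, elim conjE)
  fix p :: "nat \<Rightarrow> 'a \<times> 'a" and l
  assume p: "\<forall>n. p n \<in> {p. \<exists>s\<in>{-r..r}. fst p + s *\<^sub>R snd p \<notin> \<Omega>}" and l: "p \<longlonglongrightarrow> l"
  then have "\<forall>n. \<exists>s. s \<in> {-r..r} \<and> fst (p n) + s *\<^sub>R snd (p n) \<notin> \<Omega>" by blast
  then obtain s where s: "\<And>n. s n \<in> {-r..r}" "\<And>n. fst (p n) + s n *\<^sub>R snd (p n) \<notin> \<Omega>"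
    unfolding choice_iff by blast
  have "seq_compact {-r..r}" using compact_Icc compact_imp_seq_compact by blast
  then have "\<exists>s0\<in>{-r..r}. \<exists>q. strict_mono q \<and> (s \<circ> q) \<longlonglongrightarrow> s0"
    unfolding seq_compact_def using s(1) by simp
  then obtain s0 q where q: "s0 \<in> {-r..r}" "strict_mono q" "(s \<circ> q) \<longlonglongrightarrow> s0" by blast
  have "(p \<circ> q) \<longlonglongrightarrow> l" using l q(2) by (rule LIMSEQ_subseq_LIMSEQ)
  then have lim: "(\<lambda>n. fst ((p \<circ> q) n) + (s \<circ> q) n *\<^sub>R snd ((p \<circ> q) n)) \<longlonglongrightarrow> fst l + s0 *\<^sub>R snd l"
    by (intro tendsto_intros q(3))
  have cl: "closed (- \<Omega>)" using assms by (rule closed_Compl)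
  have "fst ((p \<circ> q) n) + (s \<circ> q) n *\<^sub>R snd ((p \<circ> q) n) \<in> - \<Omega>" for n
    using s(2) by simp
  from closed_sequentially[OF cl this lim] have "fst l + s0 *\<^sub>R snd l \<in> - \<Omega>" .
  with q(1) show "l \<in> {p. \<exists>s\<in>{-r..r}. fst p + s *\<^sub>R snd p \<notin> \<Omega>}" by blast
qed

text \<open>Measurability in point and direction jointly is what Tonelli's theorem needs later. A
  strict sublevel set is a countable union, over rational bounds, of the closed sets of
  \<open>closed_dist_dir\<close>.\<close>

lemma borel_measurable_dist_dir:
  fixes \<Omega> :: "'a::euclidean_space set"
  assumes "open \<Omega>"
  shows "(\<lambda>p. dist_dir \<Omega> (snd p) (fst p)) \<in> borel_measurable (borel \<Otimes>\<^sub>M borel)"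
  unfolding borel_prod
proof (rule borel_measurableI_less)
  fix a :: ennreal
  have "{p. dist_dir \<Omega> (snd p) (fst p) < a}
    = (\<Union>q\<in>{q::rat. ennreal (of_rat q) < a}. {p. \<exists>s\<in>{- of_rat q..of_rat q}. fst p + s *\<^sub>R snd p \<notin> \<Omega>})" (is "?L = ?R")
  proof (intro set_eqI iffI)
    fix p assume "p \<in> ?L"
    then obtain s where s: "fst p + s *\<^sub>R snd p \<notin> \<Omega>" "ennreal \<bar>s\<bar> < a"
      by (auto simp: dist_dir_def INF_less_iff)
    \<comment> \<open>A real number strictly between |s| and \<open>a\<close>, which may be top,
      leaves room for a rational one.\<close>
    obtain b where b: "\<bar>s\<bar> < b" "ennreal b < a"
    proof (cases a)
      case (real r)
      then have "\<bar>s\<bar> < r" using s(2) by (simp add: ennreal_less_iff)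
      then obtain b where "\<bar>s\<bar> < b" "b < r" using dense by blast
      then show ?thesis using real that[of b] by (simp add: ennreal_less_iff)
    next
      case top
      then show ?thesis using that[of "\<bar>s\<bar> + 1"] by simp
    qed
    obtain q :: rat where "\<bar>s\<bar> < of_rat q" "of_rat q < b" using of_rat_dense[OF b(1)] by blast
    moreover from this have "ennreal (of_rat q) < a"
      using b(2) by (meson ennreal_leI le_less_trans less_imp_le)
    ultimately show "p \<in> ?R"
      using s(1) by (intro UN_I[of q] CollectI bexI[of _ s]) auto
  next
    fix p assume "p \<in> ?R"
    then obtain q :: rat and s where "ennreal (of_rat q) < a" "s \<in> {- of_rat q..of_rat q}" "fst p + s *\<^sub>R snd p \<notin> \<Omega>"
      by blast
    then have s: "ennreal (of_rat q) < a" "\<bar>s\<bar> \<le> of_rat q" "fst p + s *\<^sub>R snd p \<notin> \<Omega>" by auto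
    then have "ennreal \<bar>s\<bar> < a" using ennreal_leI[OF s(2)] by (simp add: le_less_trans)
    then show "p \<in> ?L" using s(3) by (auto simp: dist_dir_def INF_less_iff)
  qed
  also have "\<dots> \<in> sets borel"
    by (intro sets.countable_UN'' countableI_type borel_closed closed_dist_dir assms)
  finally show "{p \<in> space borel. dist_dir \<Omega> (snd p) (fst p) < a} \<in> sets borel" by simp
qed

text \<open>Fubini along the lines in direction \<open>y\<close>: the slab \<open>0 \<le> x \<bullet> y / (y \<bullet> y) < 1\<close> meets each
  line in a segment of parameter length one.\<close>

lemma nn_integral_lborel_lines:
  fixes h :: "'a::euclidean_space \<Rightarrow> ennreal"
  assumes [measurable]: "h \<in> borel_measurable borel" and "y \<noteq> 0"
  shows "(\<integral>\<^sup>+x. h x \<partial>lborel)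
    = (\<integral>\<^sup>+x. indicator {x. 0 \<le> x \<bullet> y / (y \<bullet> y) \<and> x \<bullet> y / (y \<bullet> y) < 1} x * (\<integral>\<^sup>+t. h (x + t *\<^sub>R y) \<partial>lborel) \<partial>lborel)"
proof -
  define slab :: "'a \<Rightarrow> ennreal" where "slab = indicator {x. 0 \<le> x \<bullet> y / (y \<bullet> y) \<and> x \<bullet> y / (y \<bullet> y) < 1}"
  have [measurable]: "slab \<in> borel_measurable borel" unfolding slab_def by measurable
  have one: "(\<integral>\<^sup>+t. slab (x - t *\<^sub>R y) \<partial>lborel) = 1" for x
  proof -
    define a where "a = x \<bullet> y / (y \<bullet> y)"
    have "(x - t *\<^sub>R y) \<bullet> y / (y \<bullet> y) = a - t" for t
      using \<open>y \<noteq> 0\<close> by (simp add: a_def inner_simps diff_divide_distrib)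
    then have "slab (x - t *\<^sub>R y) = indicator {a - 1<..a} t" for t
      unfolding slab_def by (auto simp: indicator_def)
    then show ?thesis by simp
  qed
  have "(\<integral>\<^sup>+x. slab x * (\<integral>\<^sup>+t. h (x + t *\<^sub>R y) \<partial>lborel) \<partial>lborel)
     = (\<integral>\<^sup>+x. (\<integral>\<^sup>+t. slab x * h (x + t *\<^sub>R y) \<partial>lborel) \<partial>lborel)"
    by (simp add: nn_integral_cmult)
  also have "\<dots> = (\<integral>\<^sup>+t. (\<integral>\<^sup>+x. slab x * h (x + t *\<^sub>R y) \<partial>lborel) \<partial>lborel)"
    by (rule lborel_pair.Fubini') measurable
  \<comment> \<open>For fixed t, translating x by t y moves the shift from \<open>h\<close> to the
    slab, whose integral over t is 1.\<close>
  also have "\<dots> = (\<integral>\<^sup>+t. (\<integral>\<^sup>+x. slab (x - t *\<^sub>R y) * h x \<partial>lborel) \<partial>lborel)"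
  proof (rule nn_integral_cong)
    fix t :: real
    show "(\<integral>\<^sup>+x. slab x * h (x + t *\<^sub>R y) \<partial>lborel) = (\<integral>\<^sup>+x. slab (x - t *\<^sub>R y) * h x \<partial>lborel)"
      using nn_integral_lborel_translate[of "\<lambda>x. slab (x - t *\<^sub>R y) * h x" "t *\<^sub>R y"] by (simp add: add.commute)
  qed
  also have "\<dots> = (\<integral>\<^sup>+x. (\<integral>\<^sup>+t. slab (x - t *\<^sub>R y) * h x \<partial>lborel) \<partial>lborel)"
    by (rule lborel_pair.Fubini') measurable
  also have "\<dots> = (\<integral>\<^sup>+x. h x \<partial>lborel)"
    by (simp add: nn_integral_multc one)
  finally show ?thesis by (simp add: slab_def)
qed

text \<open>On the line t \<mapsto> x + t y the preimage of \<Omega> is an open set of parameters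
  whose one-dimensional distance is exactly \<open>dist_dir \<Omega> y\<close>, and the
  \<open>dder y k f\<close> restrict to successive derivatives. Averaging over parallel lines gives
  the space integrals.\<close>

lemma hardy_direction:
  fixes f :: "'a::euclidean_space \<Rightarrow> complex"
  assumes \<Omega>: "open \<Omega>" and f: "test_fun \<Omega> f" and m: "m \<ge> 1"
  shows "ennreal (hardy_const m) * (\<integral>\<^sup>+x. ennreal ((cmod (f x))\<^sup>2) * inverse (dist_dir \<Omega> y x ^ (2 * m)) \<partial>lborel)
    \<le> (\<integral>\<^sup>+x. ennreal ((cmod (dder y m f x))\<^sup>2) \<partial>lborel)"
proof -
  obtain K where K: "compact K" "K \<subseteq> \<Omega>" "\<And>x. x \<notin> K \<Longrightarrow> f x = 0" using test_fun_support[OF f] by blast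
  have s: "smooth_fun f" using f by (simp add: test_fun_def)
  have [measurable]: "f \<in> borel_measurable borel" "dder y m f \<in> borel_measurable borel"
    by (intro borel_measurable_continuous_onI smooth_fun_continuous dder_continuous s)+
  have [measurable]: "(\<lambda>x. dist_dir \<Omega> y x) \<in> borel_measurable borel"
    using measurable_compose[OF _ borel_measurable_dist_dir[OF \<Omega>], of "\<lambda>x. (x, y)" borel] by simp
  show ?thesis
  proof (cases "y = 0")
    \<comment> \<open>For y = 0 there is no line. Inside \<Omega> the distance is top and the weight
      0; outside \<Omega> the function \<open>f\<close> vanishes.\<close>
    case True
    have "ennreal ((cmod (f x))\<^sup>2) * inverse (dist_dir \<Omega> y x ^ (2 * m)) = 0" for x
    proof (cases "x \<in> \<Omega>")
      case True
      then have "dist_dir \<Omega> y x = top" using \<open>y = 0\<close> by (simp add: dist_dir_def)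
      then show ?thesis using m by simp
    next
      case False
      then show ?thesis using K(2,3) by auto
    qed
    then have "(\<integral>\<^sup>+x. ennreal ((cmod (f x))\<^sup>2) * inverse (dist_dir \<Omega> y x ^ (2 * m)) \<partial>lborel) = (\<integral>\<^sup>+x. 0 \<partial>(lborel :: 'a measure))"
      by (intro nn_integral_cong)
    then show ?thesis by simp
  next
    case False
    have line: "ennreal (hardy_const m) * (\<integral>\<^sup>+t. ennreal ((cmod (f (x + t *\<^sub>R y)))\<^sup>2) * inverse (dist_dir \<Omega> y (x + t *\<^sub>R y) ^ (2 * m)) \<partial>lborel)
        \<le> (\<integral>\<^sup>+t. ennreal ((cmod (dder y m f (x + t *\<^sub>R y)))\<^sup>2) \<partial>lborel)" for x
    proof -
      define U where "U = (\<lambda>t. x + t *\<^sub>R y) -` \<Omega>"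
      define L where "L = (\<lambda>t. x + t *\<^sub>R y) -` K"
      have "dist_dir U 1 t = dist_dir \<Omega> y (x + t *\<^sub>R y)" for t
        unfolding dist_dir_def U_def by (simp add: scaleR_add_left add.assoc)
      moreover have "ennreal (hardy_const m) * (\<integral>\<^sup>+t. ennreal ((cmod (dder y 0 f (x + t *\<^sub>R y)))\<^sup>2) * inverse (dist_dir U 1 t ^ (2 * m)) \<partial>lborel)
        \<le> (\<integral>\<^sup>+t. ennreal ((cmod (dder y m f (x + t *\<^sub>R y)))\<^sup>2) \<partial>lborel)"
      proof (rule hardy_open[of "\<lambda>k t. dder y k f (x + t *\<^sub>R y)"])
        show "((\<lambda>t. dder y k f (x + t *\<^sub>R y)) has_vector_derivative dder y (Suc k) f (x + t *\<^sub>R y)) (at t)" for k t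
          by (rule dder_has_vector_derivative[OF s])
        show "open U"
          unfolding U_def by (intro open_vimage \<Omega> continuous_intros)
        show "L \<subseteq> U" using K(2) by (auto simp: L_def U_def)
        show "compact L"
        proof -
          have "closed L"
            unfolding L_def by (intro closed_vimage compact_imp_closed K continuous_intros)
          moreover obtain B where B: "\<And>z. z \<in> K \<Longrightarrow> norm z \<le> B"
            using compact_imp_bounded[OF K(1)] by (auto simp: bounded_iff)
          have "\<bar>t\<bar> \<le> (B + norm x) / norm y" if "t \<in> L" for t
          proof -
            have "\<bar>t\<bar> * norm y = norm ((x + t *\<^sub>R y) - x)" by simp
            also have "\<dots> \<le> norm (x + t *\<^sub>R y) + norm x" by (rule norm_triangle_ineq4)
            also have "\<dots> \<le> B + norm x" using B that by (auto simp: L_def)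
            finally show ?thesis using False by (simp add: field_simps)
          qed
          then have "bounded L" by (auto simp: bounded_iff)
          ultimately show ?thesis by (simp add: compact_eq_bounded_closed)
        qed
        show "dder y k f (x + t *\<^sub>R y) = 0" if "t \<notin> L" for k t
          using that by (intro dder_outside[OF compact_imp_closed[OF K(1)] K(3)]) (auto simp: L_def)
      qed (rule m)
      ultimately show ?thesis by simp
    qed
    define slab :: "'a \<Rightarrow> ennreal" where "slab = indicator {x. 0 \<le> x \<bullet> y / (y \<bullet> y) \<and> x \<bullet> y / (y \<bullet> y) < 1}"
    have [measurable]: "slab \<in> borel_measurable borel" unfolding slab_def by measurable
    have "ennreal (hardy_const m) * (\<integral>\<^sup>+x. ennreal ((cmod (f x))\<^sup>2) * inverse (dist_dir \<Omega> y x ^ (2 * m)) \<partial>lborel)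
       = ennreal (hardy_const m) * (\<integral>\<^sup>+x. slab x * (\<integral>\<^sup>+t. ennreal ((cmod (f (x + t *\<^sub>R y)))\<^sup>2) * inverse (dist_dir \<Omega> y (x + t *\<^sub>R y) ^ (2 * m)) \<partial>lborel) \<partial>lborel)"
      unfolding slab_def by (subst nn_integral_lborel_lines[OF _ False]) auto
    also have "\<dots> = (\<integral>\<^sup>+x. ennreal (hardy_const m) * (slab x * (\<integral>\<^sup>+t. ennreal ((cmod (f (x + t *\<^sub>R y)))\<^sup>2) * inverse (dist_dir \<Omega> y (x + t *\<^sub>R y) ^ (2 * m)) \<partial>lborel)) \<partial>lborel)"
      by (rule nn_integral_cmult[symmetric]) measurable
    also have "\<dots> \<le> (\<integral>\<^sup>+x. slab x * (\<integral>\<^sup>+t. ennreal ((cmod (dder y m f (x + t *\<^sub>R y)))\<^sup>2) \<partial>lborel) \<partial>lborel)"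
      using line by (intro nn_integral_mono) (simp add: mult.left_commute[of "ennreal (hardy_const m)"] mult_left_mono)
    also have "\<dots> = (\<integral>\<^sup>+x. ennreal ((cmod (dder y m f x))\<^sup>2) \<partial>lborel)"
      unfolding slab_def by (rule nn_integral_lborel_lines[OF _ False, symmetric]) measurable
    finally show ?thesis .
  qed
qed

section \<open>The inequality for test functions and its closure\<close>

definition rellich_const :: "'a::euclidean_space itself \<Rightarrow> nat \<Rightarrow> real" where
  "rellich_const _ m = (\<Prod>k<m. real (DIM('a) + 2 * k)) * (\<Prod>k<m. real (2 * k + 1)) / 4 ^ m"

lemma hardy_const_eq: "hardy_const m = (\<Prod>k<m. real (2 * k + 1)) * (\<Prod>k<m. real (2 * k + 1)) / 4 ^ m"
proof (induction m)
  case (Suc m)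
  have "hardy_const (Suc m) = hardy_const m * ((2 * real m + 1) / 2)\<^sup>2"
    by (simp add: hardy_const_def)
  then show ?case unfolding Suc by (simp add: power2_eq_square field_simps)
qed (simp add: hardy_const_def)

lemma borel_measurable_pseudo_dist_pow_inv:
  fixes \<Omega> :: "'a::euclidean_space set"
  assumes "open \<Omega>"
  shows "pseudo_dist_pow_inv m \<Omega> \<in> borel_measurable borel"
proof -
  interpret S: prob_space "sphere_measure :: 'a measure" by (rule prob_space_sphere_measure)
  have "(\<lambda>p. dist_dir \<Omega> (snd p) (fst p)) \<in> borel_measurable (borel \<Otimes>\<^sub>M sphere_measure)"
    using borel_measurable_dist_dir[OF assms]
    by (subst measurable_cong_sets[OF sets_pair_measure_cong[OF refl sets_sphere_measure] refl])
  then have "(\<lambda>x. \<integral>\<^sup>+\<omega>. inverse (dist_dir \<Omega> \<omega> x ^ (2 * m)) \<partial>sphere_measure) \<in> borel_measurable borel"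
    by (intro S.borel_measurable_nn_integral) (simp add: case_prod_beta)
  then show ?thesis by (simp add: pseudo_dist_pow_inv_def[abs_def])
qed

text \<open>The weight is homogeneous of degree 2m in \<open>y\<close>, so polar coordinates split
  the average into the spherical integral defining the pseudodistance and the Gaussian moment of
  |y|^(2m).\<close>

lemma gauss_average_dist_dir:
  fixes \<Omega> :: "'a::euclidean_space set"
  assumes "open \<Omega>"
  shows "(\<integral>\<^sup>+y. ennreal (gauss y) * inverse (dist_dir \<Omega> y x ^ (2 * m)) \<partial>lborel)
    = pseudo_dist_pow_inv m \<Omega> x * ennreal ((\<Prod>k<m. real (DIM('a) + 2 * k)) * gauss_mass TYPE('a))"
proof -
  have [measurable]: "(\<lambda>y. dist_dir \<Omega> y x) \<in> borel_measurable borel"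
    using measurable_compose[OF _ borel_measurable_dist_dir[OF assms], of "\<lambda>y. (x, y)" borel] by simp
  define v where "v r = ennreal (exp (- r\<^sup>2 / 2) * r ^ (2 * m))" for r :: real
  have [measurable]: "v \<in> borel_measurable borel" unfolding v_def by measurable
  have v: "v (norm y) = ennreal (gauss y * (y \<bullet> y) ^ m)" for y :: 'a
    by (simp add: v_def gauss_def power_mult power2_norm_eq_inner)
  have "(\<integral>\<^sup>+y. ennreal (gauss y) * inverse (dist_dir \<Omega> y x ^ (2 * m)) \<partial>lborel)
      = (\<integral>\<^sup>+y. inverse (dist_dir \<Omega> (sgn y) x ^ (2 * m)) * v (norm y) \<partial>lborel)"
  proof (rule nn_integral_cong_AE)
    show "AE y in lborel. ennreal (gauss y) * inverse (dist_dir \<Omega> y x ^ (2 * m))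
        = inverse (dist_dir \<Omega> (sgn y) x ^ (2 * m)) * v (norm y)"
      using AE_lborel_singleton[of "0::'a"]
    proof eventually_elim
      case (elim y)
      have "v (norm y) = ennreal (gauss y) * ennreal (norm y ^ (2 * m))"
        unfolding v by (simp add: ennreal_mult'[symmetric] gauss_pos less_imp_le power_mult power2_norm_eq_inner)
      then show ?case
        by (simp only: inverse_dist_dir_sgn[OF elim] mult_ac)
    qed
  qed
  also have "\<dots> = (\<integral>\<^sup>+\<omega>. inverse (dist_dir \<Omega> \<omega> x ^ (2 * m)) \<partial>sphere_measure) * (\<integral>\<^sup>+y. v (norm (y::'a)) \<partial>lborel)"
    by (rule nn_integral_polar) measurable
  also have "(\<integral>\<^sup>+y. v (norm (y::'a)) \<partial>lborel) = ennreal (\<integral>y. gauss y * (y \<bullet> y) ^ m \<partial>(lborel :: 'a measure))"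
  proof -
    have "norm y ^ (2 * m) = (y \<bullet> y) ^ m" for y :: 'a
      by (simp only: power_mult power2_norm_eq_inner)
    then have "integrable lborel (\<lambda>y::'a. gauss y * (y \<bullet> y) ^ m)"
      using integrable_norm_power_gauss[of "2 * m", where 'a='a] by (simp add: mult.commute)
    then show ?thesis
      unfolding v by (rule nn_integral_eq_integral) (auto simp: gauss_pos less_imp_le)
  qed
  finally show ?thesis by (simp add: gauss_moment pseudo_dist_pow_inv_def)
qed

lemma dder_energy_nonneg: "0 \<le> dder_energy m f y"
  by (simp add: dder_energy_def)

text \<open>Integrate \<open>hardy_direction\<close> against \<open>gauss y\<close> and exchange the
  integrals. The weight side becomes \<open>hardy_const m\<close> P Z I and the energy side D Z
  \<open>Qm m f\<close>, where I is the weighted integral.\<close>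

lemma rellich_test_fun:
  fixes f :: "'a::euclidean_space \<Rightarrow> complex"
  assumes \<Omega>: "open \<Omega>" and f: "test_fun \<Omega> f" and m: "m \<ge> 1"
  shows "ennreal (rellich_const TYPE('a) m) * (\<integral>\<^sup>+x. ennreal ((cmod (f x))\<^sup>2) * pseudo_dist_pow_inv m \<Omega> x \<partial>lborel)
    \<le> ennreal (Qm m f)"
proof -
  define P where "P = (\<Prod>k<m. real (DIM('a) + 2 * k))"
  define D where "D = (\<Prod>k<m. real (2 * k + 1))"
  define Z where "Z = gauss_mass TYPE('a)"
  have D: "0 < D" unfolding D_def by (intro prod_pos) auto
  have P: "0 \<le> P" unfolding P_def by (intro prod_nonneg) auto
  have Z: "0 < Z" unfolding Z_def by (rule gauss_mass_pos)
  obtain K where K: "compact K" "K \<subseteq> \<Omega>" "\<And>x. x \<notin> K \<Longrightarrow> f x = 0" using test_fun_support[OF f] by blast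
  have s: "smooth_fun f" using f by (simp add: test_fun_def)
  have [measurable]: "f \<in> borel_measurable borel"
    by (intro borel_measurable_continuous_onI smooth_fun_continuous s)
  have dm[measurable]: "(\<lambda>p. dist_dir \<Omega> (snd p) (fst p)) \<in> borel_measurable (borel \<Otimes>\<^sub>M borel)"
    by (rule borel_measurable_dist_dir[OF \<Omega>])
  have [measurable]: "(\<lambda>x. dist_dir \<Omega> y x) \<in> borel_measurable borel" for y
    using measurable_compose[OF _ dm, of "\<lambda>x. (x, y)" borel] by simp
  have [measurable]: "(\<lambda>y. dist_dir \<Omega> y x) \<in> borel_measurable borel" for x
    using measurable_compose[OF _ dm, of "\<lambda>y. (x, y)" borel] by simp
  have dm2[measurable]: "(\<lambda>p. dist_dir \<Omega> (fst p) (snd p)) \<in> borel_measurable (borel \<Otimes>\<^sub>M borel)"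
    using measurable_compose[OF _ dm, of "\<lambda>p. (snd p, fst p)" "borel \<Otimes>\<^sub>M borel"] by simp
  define I where "I = (\<integral>\<^sup>+x. ennreal ((cmod (f x))\<^sup>2) * pseudo_dist_pow_inv m \<Omega> x \<partial>lborel)"
  have energy: "(\<integral>\<^sup>+x. ennreal ((cmod (dder y m f x))\<^sup>2) \<partial>lborel) = ennreal (dder_energy m f y)" for y
    unfolding dder_energy_def
    by (rule nn_integral_eq_integral[OF integrable_dder_square[OF s K(1,3)]]) auto
  have "ennreal (hardy_const m) * (ennreal (P * Z) * I)
    = ennreal (hardy_const m) * (\<integral>\<^sup>+x. ennreal ((cmod (f x))\<^sup>2) * (pseudo_dist_pow_inv m \<Omega> x * ennreal (P * Z)) \<partial>lborel)"
    unfolding I_def using borel_measurable_pseudo_dist_pow_inv[OF \<Omega>, of m]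
    by (subst nn_integral_cmult[symmetric]) (auto simp: mult_ac)
  also have "\<dots> = ennreal (hardy_const m) * (\<integral>\<^sup>+x. ennreal ((cmod (f x))\<^sup>2)
      * (\<integral>\<^sup>+y. ennreal (gauss y) * inverse (dist_dir \<Omega> y x ^ (2 * m)) \<partial>lborel) \<partial>lborel)"
    unfolding gauss_average_dist_dir[OF \<Omega>] P_def Z_def ..
  also have "\<dots> = ennreal (hardy_const m) * (\<integral>\<^sup>+x. (\<integral>\<^sup>+y. ennreal ((cmod (f x))\<^sup>2)
      * (ennreal (gauss y) * inverse (dist_dir \<Omega> y x ^ (2 * m))) \<partial>lborel) \<partial>lborel)"
    by (subst nn_integral_cmult) auto
  also have "\<dots> = ennreal (hardy_const m) * (\<integral>\<^sup>+y. (\<integral>\<^sup>+x. ennreal ((cmod (f x))\<^sup>2)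
      * (ennreal (gauss y) * inverse (dist_dir \<Omega> y x ^ (2 * m))) \<partial>lborel) \<partial>lborel)"
  proof -
    have "(\<lambda>(y, x). ennreal ((cmod (f x))\<^sup>2) * (ennreal (gauss y) * inverse (dist_dir \<Omega> y x ^ (2 * m))))
      \<in> borel_measurable (lborel \<Otimes>\<^sub>M lborel)"
      unfolding case_prod_beta by measurable
    from lborel_pair.Fubini'[OF this] show ?thesis by simp
  qed
  also have "\<dots> = (\<integral>\<^sup>+y. ennreal (gauss y) * (ennreal (hardy_const m)
      * (\<integral>\<^sup>+x. ennreal ((cmod (f x))\<^sup>2) * inverse (dist_dir \<Omega> y x ^ (2 * m)) \<partial>lborel)) \<partial>lborel)"
  proof -
    have e: "(\<integral>\<^sup>+x. ennreal ((cmod (f x))\<^sup>2) * (ennreal (gauss y) * inverse (dist_dir \<Omega> y x ^ (2 * m))) \<partial>lborel)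
      = ennreal (gauss y) * (\<integral>\<^sup>+x. ennreal ((cmod (f x))\<^sup>2) * inverse (dist_dir \<Omega> y x ^ (2 * m)) \<partial>lborel)" for y
      by (subst nn_integral_cmult[symmetric]) (auto simp: mult_ac)
    have "(\<lambda>y. \<integral>\<^sup>+x. ennreal ((cmod (f x))\<^sup>2) * inverse (dist_dir \<Omega> y x ^ (2 * m)) \<partial>lborel) \<in> borel_measurable borel"
      by (intro lborel.borel_measurable_nn_integral) (unfold case_prod_beta, measurable)
    then show ?thesis
      unfolding e by (subst nn_integral_cmult[symmetric]) (auto simp: mult_ac)
  qed
  also have "\<dots> \<le> (\<integral>\<^sup>+y. ennreal (gauss y) * ennreal (dder_energy m f y) \<partial>lborel)"
    using hardy_direction[OF \<Omega> f m] unfolding energy by (intro nn_integral_mono mult_left_mono) auto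
  also have "\<dots> = (\<integral>\<^sup>+y. ennreal (gauss y * dder_energy m f y) \<partial>lborel)"
    by (simp add: ennreal_mult gauss_pos less_imp_le dder_energy_nonneg)
  also have "\<dots> = ennreal (\<integral>y. gauss y * dder_energy m f y \<partial>lborel)"
    by (rule nn_integral_eq_integral[OF gauss_dder_energy(1)[OF f]])
      (simp add: gauss_pos less_imp_le dder_energy_nonneg)
  also have "\<dots> = ennreal (D * Z * Qm m f)"
    by (simp only: gauss_dder_energy(2)[OF f] D_def Z_def)
  finally have main: "ennreal (hardy_const m) * (ennreal (P * Z) * I) \<le> ennreal (D * Z * Qm m f)" .
  \<comment> \<open>Since \<open>hardy_const m\<close> is D^2 / 4^m, dividing by D Z cancels the
    mass and one of the two double factorials.\<close>
  have eq: "rellich_const TYPE('a) m = 1 / (D * Z) * (hardy_const m * (P * Z))"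
    using D Z unfolding rellich_const_def hardy_const_eq P_def[symmetric] D_def[symmetric]
    by (simp add: field_simps)
  have "ennreal (rellich_const TYPE('a) m) * I = ennreal (1 / (D * Z)) * (ennreal (hardy_const m) * (ennreal (P * Z) * I))"
  proof -
    have "0 \<le> 1 / (D * Z)" using D Z by simp
    then have "ennreal (1 / (D * Z) * (hardy_const m * (P * Z)))
      = ennreal (1 / (D * Z)) * (ennreal (hardy_const m) * ennreal (P * Z))"
      by (simp only: ennreal_mult' hardy_const_nonneg)
    with eq show ?thesis by (simp only: mult.assoc)
  qed
  also have "\<dots> \<le> ennreal (1 / (D * Z)) * ennreal (D * Z * Qm m f)"
    by (intro mult_left_mono main) simp
  also have "\<dots> = ennreal (1 / (D * Z) * (D * Z * Qm m f))"
    using D Z by (intro ennreal_mult'[symmetric]) simp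
  also have "1 / (D * Z) * (D * Z * Qm m f) = Qm m f"
    using D Z by simp
  finally show ?thesis by (simp add: I_def)
qed

section \<open>The quadratic form along form-Cauchy sequences of test functions\<close>

lemma Qm_eq:
  fixes f :: "'a::euclidean_space \<Rightarrow> complex"
  assumes "test_fun \<Omega> f"
  shows "Qm m f = (\<integral>y. gauss y * dder_energy m f y \<partial>lborel) / ((\<Prod>k<m. real (2 * k + 1)) * gauss_mass TYPE('a))"
proof -
  have "(\<Prod>k<m. real (2 * k + 1)) \<noteq> 0" by (simp add: prod_zero_iff)
  then show ?thesis
    using gauss_mass_pos[where 'a='a] by (simp add: gauss_dder_energy(2)[OF assms] del: of_nat_add of_nat_mult)
qed

text \<open>The Gaussian mean of the energies makes positivity visible, as the Fourier
  representation of the form would.\<close>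

lemma Qm_nonneg: "test_fun \<Omega> f \<Longrightarrow> 0 \<le> Qm m f"
  unfolding Qm_eq
  by (intro divide_nonneg_nonneg mult_nonneg_nonneg prod_nonneg Bochner_Integration.integral_nonneg)
    (auto simp: gauss_pos less_imp_le dder_energy_nonneg gauss_mass_pos)

lemma test_fun_diff:
  assumes f: "test_fun \<Omega> f" and g: "test_fun \<Omega> g"
  shows "test_fun \<Omega> (\<lambda>x. f x - g x)"
proof -
  obtain K where K: "compact K" "K \<subseteq> \<Omega>" "\<And>x. x \<notin> K \<Longrightarrow> f x = 0" using test_fun_support[OF f] by blast
  obtain L where L: "compact L" "L \<subseteq> \<Omega>" "\<And>x. x \<notin> L \<Longrightarrow> g x = 0" using test_fun_support[OF g] by blast
  have c: "compact (K \<union> L)" using K L by (intro compact_Un)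
  have "{x. f x - g x \<noteq> 0} \<subseteq> K \<union> L"
  proof
    fix x assume "x \<in> {x. f x - g x \<noteq> 0}"
    then have "f x \<noteq> 0 \<or> g x \<noteq> 0" by auto
    then show "x \<in> K \<union> L" using K(3) L(3) by blast
  qed
  then have sub: "closure {x. f x - g x \<noteq> 0} \<subseteq> K \<union> L"
    using compact_imp_closed[OF c] by (rule closure_minimal)
  then have "compact (closure {x. f x - g x \<noteq> 0})"
    using c by (metis closed_closure compact_Int_closed inf.absorb_iff2)
  then show ?thesis
    using sub K(2) L(2) smooth_fun_diff f g unfolding test_fun_def by auto
qed

lemma norm_add_square_le:
  fixes a b :: complex
  assumes "0 < e"
  shows "(cmod (a + b))\<^sup>2 \<le> (1 + e) * (cmod a)\<^sup>2 + (1 + 1 / e) * (cmod b)\<^sup>2"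
proof -
  have "0 \<le> (sqrt e * cmod a - cmod b / sqrt e)\<^sup>2" by simp
  also have "\<dots> = e * (cmod a)\<^sup>2 - 2 * cmod a * cmod b + (cmod b)\<^sup>2 / e"
    using assms by (simp add: power2_diff power_mult_distrib power_divide)
  finally have "2 * cmod a * cmod b \<le> e * (cmod a)\<^sup>2 + (cmod b)\<^sup>2 / e" by simp
  moreover have "(cmod (a + b))\<^sup>2 \<le> (cmod a + cmod b)\<^sup>2"
    by (intro power_mono norm_triangle_ineq) auto
  ultimately show ?thesis by (simp add: power2_sum algebra_simps)
qed

text \<open>Young's inequality for complex numbers passes through the Gaussian representation to the
  form, replacing the triangle inequality for its square root. The leading coefficient 1 + e can be
  taken as close to 1 as desired, which is what convergence of the values requires.\<close>

lemma Qm_quasi_triangle: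
  fixes f g :: "'a::euclidean_space \<Rightarrow> complex"
  assumes f: "test_fun \<Omega> f" and g: "test_fun \<Omega> g" and e: "0 < e"
  shows "Qm m f \<le> (1 + e) * Qm m g + (1 + 1 / e) * Qm m (\<lambda>x. f x - g x)"
proof -
  note d = test_fun_diff[OF f g]
  have energy: "dder_energy m f y \<le> (1 + e) * dder_energy m g y + (1 + 1 / e) * dder_energy m (\<lambda>x. f x - g x) y" for y
  proof -
    have int: "integrable lborel (\<lambda>x. (cmod (dder y m h x))\<^sup>2)" if "test_fun \<Omega> h" for h
      using test_fun_support[OF that] that integrable_dder_square[of h] by (auto simp: test_fun_def)
    have sm: "smooth_fun f" "smooth_fun g" using f g by (auto simp: test_fun_def)
    have "dder_energy m f y \<le> (\<integral>x. (1 + e) * (cmod (dder y m g x))\<^sup>2 + (1 + 1 / e) * (cmod (dder y m (\<lambda>x. f x - g x) x))\<^sup>2 \<partial>lborel)"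
      unfolding dder_energy_def
    proof (rule integral_mono)
      show "(cmod (dder y m f x))\<^sup>2 \<le> (1 + e) * (cmod (dder y m g x))\<^sup>2 + (1 + 1 / e) * (cmod (dder y m (\<lambda>x. f x - g x) x))\<^sup>2" for x
        using norm_add_square_le[OF e, of "dder y m g x" "dder y m f x - dder y m g x"]
        by (simp add: dder_diff[OF sm])
    qed (intro int f Bochner_Integration.integrable_add integrable_mult_right g d)+
    also have "\<dots> = (1 + e) * dder_energy m g y + (1 + 1 / e) * dder_energy m (\<lambda>x. f x - g x) y"
      unfolding dder_energy_def
      by (subst Bochner_Integration.integral_add) (auto intro!: int g d)
    finally show ?thesis .
  qed
  define c where "c = (\<Prod>k<m. real (2 * k + 1)) * gauss_mass TYPE('a)"
  have c: "0 < c" unfolding c_def by (intro mult_pos_pos prod_pos gauss_mass_pos) auto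
  have "(\<integral>y. gauss y * dder_energy m f y \<partial>lborel)
    \<le> (\<integral>y. (1 + e) * (gauss y * dder_energy m g y) + (1 + 1 / e) * (gauss y * dder_energy m (\<lambda>x. f x - g x) y) \<partial>lborel)"
  proof (rule integral_mono)
    fix y :: 'a
    have "gauss y * dder_energy m f y
      \<le> gauss y * ((1 + e) * dder_energy m g y + (1 + 1 / e) * dder_energy m (\<lambda>x. f x - g x) y)"
      using energy[of y] gauss_pos[of y] by (intro mult_left_mono) auto
    then show "gauss y * dder_energy m f y
      \<le> (1 + e) * (gauss y * dder_energy m g y) + (1 + 1 / e) * (gauss y * dder_energy m (\<lambda>x. f x - g x) y)"
      by (simp only: distrib_left mult.left_commute)
  qed (intro gauss_dder_energy(1)[OF f] gauss_dder_energy(1)[OF g] gauss_dder_energy(1)[OF d]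
      Bochner_Integration.integrable_add integrable_mult_right)+
  also have "\<dots> = (1 + e) * (\<integral>y. gauss y * dder_energy m g y \<partial>lborel)
      + (1 + 1 / e) * (\<integral>y. gauss y * dder_energy m (\<lambda>x. f x - g x) y \<partial>lborel)"
    by (subst Bochner_Integration.integral_add)
      (auto intro!: gauss_dder_energy(1)[OF g] gauss_dder_energy(1)[OF d])
  finally show ?thesis
    unfolding gauss_dder_energy(2)[OF f] gauss_dder_energy(2)[OF g] gauss_dder_energy(2)[OF d] c_def[symmetric]
    using c by (simp add: mult.left_commute[of _ c] distrib_left[symmetric])
qed

text \<open>This justifies \<open>lim\<close> in the theorem and makes every subsequence share that
  limit. A crude use of the quasi-triangle inequality bounds the values, and a fine one then shows
  that they are Cauchy.\<close>

lemma Qm_convergent: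
  fixes \<phi> :: "nat \<Rightarrow> 'a::euclidean_space \<Rightarrow> complex"
  assumes \<phi>: "\<And>n. test_fun \<Omega> (\<phi> n)"
    and cauchy: "\<forall>e>0. \<exists>M. \<forall>n\<ge>M. \<forall>k\<ge>M. Qm m (\<lambda>x. \<phi> n x - \<phi> k x) < e"
  shows "convergent (\<lambda>n. Qm m (\<phi> n))"
proof -
  obtain N where N: "\<And>n k. n \<ge> N \<Longrightarrow> k \<ge> N \<Longrightarrow> Qm m (\<lambda>x. \<phi> n x - \<phi> k x) < 1"
    using cauchy by (meson zero_less_one)
  \<comment> \<open>The bound is the quasi-triangle inequality with e = 1 against index N, where the
    difference contributes less than 2.\<close>
  define B where "B = 2 * Qm m (\<phi> N) + 2"
  have B: "Qm m (\<phi> n) \<le> B" if "n \<ge> N" for n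
    using Qm_quasi_triangle[OF \<phi>[of n] \<phi>[of N], of 1 m] N[OF that, of N] by (simp add: B_def)
  have B0: "0 < B" using Qm_nonneg[OF \<phi>[of N], of m] by (simp add: B_def)
  have "Cauchy (\<lambda>n. Qm m (\<phi> n))"
  proof (rule metric_CauchyI)
    fix e :: real assume e: "0 < e"
    \<comment> \<open>This makes \<delta> B equal to e / 2; the form of the difference, multiplied
      by 1 + 1 / \<delta>, is kept below the other half.\<close>
    define \<delta> where "\<delta> = e / (2 * B)"
    have \<delta>: "0 < \<delta>" using e B0 by (simp add: \<delta>_def)
    have "0 < e / (2 * (1 + 1 / \<delta>))" using e \<delta> by (simp add: add_pos_pos)
    then obtain M where M: "\<And>n k. n \<ge> M \<Longrightarrow> k \<ge> M \<Longrightarrow> Qm m (\<lambda>x. \<phi> n x - \<phi> k x) < e / (2 * (1 + 1 / \<delta>))"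
      using cauchy by meson
    have le: "Qm m (\<phi> n) - Qm m (\<phi> k) < e" if "n \<ge> max M N" "k \<ge> max M N" for n k
    proof -
      have "Qm m (\<phi> n) \<le> (1 + \<delta>) * Qm m (\<phi> k) + (1 + 1 / \<delta>) * Qm m (\<lambda>x. \<phi> n x - \<phi> k x)"
        by (rule Qm_quasi_triangle[OF \<phi> \<phi> \<delta>])
      moreover have "\<delta> * Qm m (\<phi> k) \<le> \<delta> * B" using B[of k] that \<delta> by (intro mult_left_mono) auto
      moreover have "\<delta> * B = e / 2" using B0 by (simp add: \<delta>_def)
      moreover have "(1 + 1 / \<delta>) * Qm m (\<lambda>x. \<phi> n x - \<phi> k x) < (1 + 1 / \<delta>) * (e / (2 * (1 + 1 / \<delta>)))"
        using M[of n k] that \<delta> by (intro mult_strict_left_mono) (auto simp: add_pos_pos)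
      moreover have "(1 + 1 / \<delta>) * (e / (2 * (1 + 1 / \<delta>))) = e / 2"
      proof -
        have "1 + 1 / \<delta> \<noteq> 0" using \<delta> by (smt (verit) divide_pos_pos)
        moreover have "x * (e / (2 * x)) = e / 2" if "x \<noteq> 0" for x :: real using that by simp
        ultimately show ?thesis by blast
      qed
      moreover have "(1 + \<delta>) * Qm m (\<phi> k) = Qm m (\<phi> k) + \<delta> * Qm m (\<phi> k)"
        by (simp add: distrib_right)
      ultimately show ?thesis by linarith
    qed
    have "dist (Qm m (\<phi> n)) (Qm m (\<phi> k)) < e" if "n \<ge> max M N" "k \<ge> max M N" for n k
      using le[OF that] le[OF that(2,1)] by (simp add: dist_real_def)
    then show "\<exists>M. \<forall>n\<ge>M. \<forall>k\<ge>M. dist (Qm m (\<phi> n)) (Qm m (\<phi> k)) < e" by blast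
  qed
  then show ?thesis by (simp add: Cauchy_convergent_iff)
qed

section \<open>Passage from test functions to the form domain\<close>

lemma divide_pseudo_dist_power:
  assumes m: "m \<ge> 1"
  shows "a / pseudo_dist m \<Omega> x ^ (2 * m) = a * pseudo_dist_pow_inv m \<Omega> x"
proof -
  define I where "I = pseudo_dist_pow_inv m \<Omega> x"
  have "inverse (pseudo_dist m \<Omega> x ^ (2 * m)) = I"
  \<comment> \<open>The values that \<open>pseudo_dist\<close> takes at I = 0 and I = \<infinity>
    are the ennreal inverses of I, and the positive exponent 2m preserves 0 and top. So inverting
    returns I there as well.\<close>
  proof (cases "I = 0 \<or> I = \<infinity>")
    case True
    then show ?thesis using m by (auto simp: pseudo_dist_def Let_def I_def[symmetric] power_0_left)
  next
    case False
    then obtain r where r: "I = ennreal r" "0 < r"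
      by (cases I) auto
    have "(r powr (- 1 / real (2 * m))) ^ (2 * m) = r powr (- 1 / real (2 * m) * real (2 * m))"
      using r(2) m by (simp add: powr_realpow[symmetric] powr_powr)
    also have "\<dots> = 1 / r" using r(2) m by (simp add: powr_minus_divide)
    finally have "ennreal (r powr (- 1 / real (2 * m))) ^ (2 * m) = ennreal (1 / r)"
      by (simp add: ennreal_power)
    then have "pseudo_dist m \<Omega> x ^ (2 * m) = ennreal (1 / r)"
      using False r by (simp add: pseudo_dist_def Let_def I_def[symmetric])
    then show ?thesis using r by (simp add: inverse_ennreal)
  qed
  then show ?thesis by (simp add: divide_ennreal_def I_def)
qed

text \<open>The first integrals may be infinite, so a tail on which they are below 1 is taken before
  the subsequence theorem for integrable functions is applied.\<close>

lemma nn_integral_tendsto_0_AE_subseq: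
  fixes u :: "nat \<Rightarrow> 'a \<Rightarrow> real"
  assumes [measurable]: "\<And>n. u n \<in> borel_measurable M" and nonneg: "\<And>n x. 0 \<le> u n x"
    and lim: "(\<lambda>n. \<integral>\<^sup>+x. ennreal (u n x) \<partial>M) \<longlonglongrightarrow> 0"
  shows "\<exists>r. strict_mono (r :: nat \<Rightarrow> nat) \<and> (AE x in M. (\<lambda>n. u (r n) x) \<longlonglongrightarrow> 0)"
proof -
  have "\<forall>\<^sub>F n in sequentially. (\<integral>\<^sup>+x. ennreal (u n x) \<partial>M) < 1"
    using order_tendstoD(2)[OF lim, of 1] by simp
  then obtain N where N: "\<And>n. n \<ge> N \<Longrightarrow> (\<integral>\<^sup>+x. ennreal (u n x) \<partial>M) < 1"
    by (auto simp: eventually_sequentially)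
  have int: "integrable M (u (n + N))" for n
    by (rule integrableI_nonneg) (use N[of "n + N"] nonneg in \<open>auto intro: less_trans\<close>)
  have "(\<lambda>n. ennreal (\<integral>x. norm (u (n + N) x) \<partial>M)) \<longlonglongrightarrow> ennreal 0"
  proof -
    have "ennreal (\<integral>x. norm (u (n + N) x) \<partial>M) = (\<integral>\<^sup>+x. ennreal (u (n + N) x) \<partial>M)" for n
      using nonneg by (simp add: nn_integral_eq_integral[OF int])
    then show ?thesis using LIMSEQ_ignore_initial_segment[OF lim, of N] by simp
  qed
  then have "(\<lambda>n. \<integral>x. norm (u (n + N) x) \<partial>M) \<longlonglongrightarrow> 0"
    by (subst (asm) tendsto_ennreal_iff) auto
  from tendsto_L1_AE_subseq[OF int this] obtain r where
    r: "strict_mono r" "AE x in M. (\<lambda>n. u (r n + N) x) \<longlonglongrightarrow> 0" by blast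
  have "strict_mono (\<lambda>n. r n + N)" using r(1) by (simp add: strict_mono_def)
  with r(2) show ?thesis by (intro exI[of _ "\<lambda>n. r n + N"]) auto
qed

text \<open>Only an inequality can hold: for l = 0 and w = top the products need not tend to 0, but
  then the left side is 0 * top = 0.\<close>

lemma mult_le_liminf:
  fixes w :: ennreal
  assumes "u \<longlonglongrightarrow> l" "\<And>n. 0 \<le> u n"
  shows "ennreal l * w \<le> liminf (\<lambda>n. ennreal (u n) * w)"
proof (cases "0 < l")
  case True
  have u: "(\<lambda>n. ennreal (u n)) \<longlonglongrightarrow> ennreal l" using assms(1) by (rule tendsto_ennrealI)
  have "(\<lambda>n. ennreal (u n) * w) \<longlonglongrightarrow> ennreal l * w"
    using u True by (intro tendsto_mult_ennreal tendsto_const) auto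
  then show ?thesis by (simp add: lim_imp_Liminf)
next
  case False
  then show ?thesis by (simp add: ennreal_neg)
qed

theorem theorem2p3:
  fixes \<Omega> :: "'a::euclidean_space set" and m :: nat
    and f :: "'a \<Rightarrow> complex" and \<phi> :: "nat \<Rightarrow> 'a \<Rightarrow> complex"
  assumes "open \<Omega>" and "connected \<Omega>" and "\<Omega> \<noteq> {}" and "m \<ge> 1"
    and "f \<in> borel_measurable lborel"
    and "(\<integral>\<^sup>+ x\<in>\<Omega>. ennreal ((cmod (f x))\<^sup>2) \<partial>lborel) < \<infinity>"
    and "\<And>n. test_fun \<Omega> (\<phi> n)"
    and "(\<lambda>n. \<integral>\<^sup>+ x\<in>\<Omega>. ennreal ((cmod (\<phi> n x - f x))\<^sup>2) \<partial>lborel) \<longlonglongrightarrow> 0"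
    and "\<forall>e>0. \<exists>M. \<forall>n\<ge>M. \<forall>k\<ge>M. Qm m (\<lambda>x. \<phi> n x - \<phi> k x) < e"
  shows "ennreal ((\<Prod>k<m. real (DIM('a) + 2 * k)) * (\<Prod>k<m. real (2 * k + 1)) / 4 ^ m)
           * (\<integral>\<^sup>+ x\<in>\<Omega>. ennreal ((cmod (f x))\<^sup>2) / pseudo_dist m \<Omega> x ^ (2 * m) \<partial>lborel)
         \<le> ennreal (lim (\<lambda>n. Qm m (\<phi> n)))"
proof -
  define W where "W = pseudo_dist_pow_inv m \<Omega>"
  define c where "c = ennreal (rellich_const TYPE('a) m)"
  have [measurable]: "W \<in> borel_measurable borel"
    unfolding W_def by (rule borel_measurable_pseudo_dist_pow_inv[OF assms(1)])
  have [measurable]: "f \<in> borel_measurable borel" using assms(5) by simp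
  have [measurable]: "\<Omega> \<in> sets borel" using assms(1) by simp
  have [measurable]: "\<phi> n \<in> borel_measurable borel" for n
    using assms(7)[of n] by (intro borel_measurable_continuous_onI smooth_fun_continuous) (simp add: test_fun_def)
  define u where "u n x = indicat_real \<Omega> x * (cmod (\<phi> n x - f x))\<^sup>2" for n x
  have "(\<integral>\<^sup>+x. ennreal (u n x) \<partial>lborel) = (\<integral>\<^sup>+ x\<in>\<Omega>. ennreal ((cmod (\<phi> n x - f x))\<^sup>2) \<partial>lborel)" for n
    by (intro nn_integral_cong) (auto simp: u_def indicator_def)
  then have "(\<lambda>n. \<integral>\<^sup>+x. ennreal (u n x) \<partial>lborel) \<longlonglongrightarrow> 0" using assms(8) by simp
  moreover have "u n \<in> borel_measurable lborel" for n unfolding u_def by measurable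
  ultimately have "\<exists>r. strict_mono (r :: nat \<Rightarrow> nat) \<and> (AE x in lborel. (\<lambda>n. u (r n) x) \<longlonglongrightarrow> 0)"
    by (intro nn_integral_tendsto_0_AE_subseq) (auto simp: u_def)
  \<comment> \<open>Fatou's lemma needs pointwise convergence, which convergence in L^2 provides
    almost everywhere along a subsequence.\<close>
  then obtain r where r: "strict_mono r" "AE x in lborel. (\<lambda>n. u (r n) x) \<longlonglongrightarrow> 0" by blast
  have fatou: "AE x in lborel. c * (ennreal ((cmod (f x))\<^sup>2) * W x * indicator \<Omega> x)
      \<le> liminf (\<lambda>n. c * (ennreal ((cmod (\<phi> (r n) x))\<^sup>2) * W x))"
    using r(2)
  proof eventually_elim
    case (elim x)
    show ?case
    proof (cases "x \<in> \<Omega>")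
      case True
      then have "(\<lambda>n. (cmod (\<phi> (r n) x - f x))\<^sup>2) \<longlonglongrightarrow> 0" using elim by (simp add: u_def)
      then have "(\<lambda>n. sqrt ((cmod (\<phi> (r n) x - f x))\<^sup>2)) \<longlonglongrightarrow> sqrt 0" by (rule tendsto_real_sqrt)
      then have "(\<lambda>n. \<phi> (r n) x - f x) \<longlonglongrightarrow> 0" by (simp add: tendsto_norm_zero_iff)
      then have "(\<lambda>n. \<phi> (r n) x) \<longlonglongrightarrow> f x" by (rule LIM_zero_cancel)
      then have "(\<lambda>n. (cmod (\<phi> (r n) x))\<^sup>2) \<longlonglongrightarrow> (cmod (f x))\<^sup>2" by (intro tendsto_intros)
      from mult_le_liminf[OF this, of "c * W x"] True show ?thesis
        by (simp add: mult_ac)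
    qed simp
  qed
  have conv: "(\<lambda>n. Qm m (\<phi> n)) \<longlonglongrightarrow> lim (\<lambda>n. Qm m (\<phi> n))"
    using Qm_convergent[OF assms(7,9)] by (simp add: convergent_LIMSEQ_iff)
  have "c * (\<integral>\<^sup>+ x\<in>\<Omega>. ennreal ((cmod (f x))\<^sup>2) / pseudo_dist m \<Omega> x ^ (2 * m) \<partial>lborel)
    = (\<integral>\<^sup>+ x. c * (ennreal ((cmod (f x))\<^sup>2) * W x * indicator \<Omega> x) \<partial>lborel)"
    unfolding divide_pseudo_dist_power[OF assms(4)] W_def[symmetric] by (rule nn_integral_cmult[symmetric]) measurable
  also have "\<dots> \<le> (\<integral>\<^sup>+ x. liminf (\<lambda>n. c * (ennreal ((cmod (\<phi> (r n) x))\<^sup>2) * W x)) \<partial>lborel)"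
    by (rule nn_integral_mono_AE[OF fatou])
  also have "\<dots> \<le> liminf (\<lambda>n. \<integral>\<^sup>+ x. c * (ennreal ((cmod (\<phi> (r n) x))\<^sup>2) * W x) \<partial>lborel)"
    by (rule nn_integral_liminf) measurable
  also have "\<dots> \<le> liminf (\<lambda>n. ennreal (Qm m (\<phi> (r n))))"
  proof (intro Liminf_mono always_eventually allI)
    fix n
    have "(\<integral>\<^sup>+ x. c * (ennreal ((cmod (\<phi> (r n) x))\<^sup>2) * W x) \<partial>lborel)
        = c * (\<integral>\<^sup>+ x. ennreal ((cmod (\<phi> (r n) x))\<^sup>2) * W x \<partial>lborel)"
      by (rule nn_integral_cmult) measurable
    also have "\<dots> \<le> ennreal (Qm m (\<phi> (r n)))"
      unfolding c_def W_def by (rule rellich_test_fun[OF assms(1,7,4)])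
    finally show "(\<integral>\<^sup>+ x. c * (ennreal ((cmod (\<phi> (r n) x))\<^sup>2) * W x) \<partial>lborel) \<le> ennreal (Qm m (\<phi> (r n)))" .
  qed
  \<comment> \<open>The values of the form converge along the whole sequence, so the subsequence
    chosen for Fatou's lemma has the same limit.\<close>
  also have "\<dots> = ennreal (lim (\<lambda>n. Qm m (\<phi> n)))"
    using LIMSEQ_subseq_LIMSEQ[OF conv r(1)]
    by (intro lim_imp_Liminf tendsto_ennrealI) (auto simp: o_def)
  finally show ?thesis unfolding c_def rellich_const_def .
qed

end
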